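(* Let $a=(a_n)_{n\ge1}$ be a non-zero periodic sequence of complex numbers, and let $F_a(s)$ be the meromorphic continuation to $\mathbb{C}$ of $\sum_{n\ge1}a_n n^{-s}$. Then there is a constant $C=C(a)>0$ such that for all $0<u\le 1/2$ and all $T\ge1$, $$N_{F_a}\Big(\tfrac12+u,+\infty,T\Big)\le C\, T\,\frac{\log(1/u)}{u}.$$
   Context: For a meromorphic function $F$, $N_F(\sigma_1,\sigma_2,T)$ denotes the number of zeros of $F$, counted with multiplicities, in the region $\sigma_1<\mathrm{Re}\, s<\sigma_2$, $|\mathrm{Im}\, s|\le T$ (here $\sigma_2=+\infty$ allowed). The series $\sum_{n\ge1}a_n n^{-s}$ with periodic coefficients has a meromorphic continuation to the whole complex plane with at most a simple pole at $s=1$. *)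

theory Defs
  imports "HOL-Complex_Analysis.Complex_Analysis"
begin

text \<open>A sequence \<open>(a\<^sub>n)\<close> with \<open>n \<ge> 1\<close> is a function on \<^typ>\<open>nat\<close> whose value at \<open>0\<close> is never
  looked at.\<close>

definition periodic_seq :: "(nat \<Rightarrow> complex) \<Rightarrow> bool" where
  "periodic_seq a \<longleftrightarrow> (\<exists>q\<ge>1. \<forall>n\<ge>1. a (n + q) = a n)"

definition nonzero_seq :: "(nat \<Rightarrow> complex) \<Rightarrow> bool" where
  "nonzero_seq a \<longleftrightarrow> (\<exists>n\<ge>1. a n \<noteq> 0)"

text \<open>\<open>F\<close> is the meromorphic continuation to the whole plane of the Dirichlet series with
  coefficients \<open>a\<close>, which for bounded \<open>a\<close> converges absolutely when \<open>Re s > 1\<close>. Asking for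
  \<^const>\<open>nicely_meromorphic_on\<close> (removable singularities are filled in, the value at a pole is
  \<open>0\<close>) makes \<open>F\<close> unique as a function.\<close>

definition is_dirichlet_continuation :: "(nat \<Rightarrow> complex) \<Rightarrow> (complex \<Rightarrow> complex) \<Rightarrow> bool" where
  "is_dirichlet_continuation a F \<longleftrightarrow>
     F nicely_meromorphic_on UNIV \<and>
     (\<forall>s. Re s > 1 \<longrightarrow> (\<lambda>n. a (Suc n) * of_nat (Suc n) powr (- s)) sums F s)"

text \<open>Zeros are detected by the limit being \<open>0\<close>, since the library assigns the value \<open>0\<close> also at
  poles.\<close>

definition zeros_in :: "(complex \<Rightarrow> complex) \<Rightarrow> real \<Rightarrow> ereal \<Rightarrow> real \<Rightarrow> complex set" where
  "zeros_in F \<sigma>\<^sub>1 \<sigma>\<^sub>2 T =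
     {s. \<sigma>\<^sub>1 < Re s \<and> ereal (Re s) < \<sigma>\<^sub>2 \<and> \<bar>Im s\<bar> \<le> T \<and> F \<midarrow>s\<rightarrow> 0}"

text \<open>The count is \<open>\<infinity>\<close> if there are infinitely many zeros, so a finite upper bound for it includes
  the finiteness of the set of zeros.\<close>

definition zero_count :: "(complex \<Rightarrow> complex) \<Rightarrow> real \<Rightarrow> ereal \<Rightarrow> real \<Rightarrow> enat" where
  "zero_count F \<sigma>\<^sub>1 \<sigma>\<^sub>2 T =
     (if finite (zeros_in F \<sigma>\<^sub>1 \<sigma>\<^sub>2 T)
      then enat (\<Sum>s\<in>zeros_in F \<sigma>\<^sub>1 \<sigma>\<^sub>2 T. nat (zorder F s))
      else \<infinity>)"

end

theory Submission
  imports Defs "HOL-Probability.Sinc_Integral"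
begin

text \<open>
  Multiplying \<open>F\<close> by \<open>1 - 2 powr (1 - s)\<close> keeps the coefficients periodic and makes their sum over a
  period vanish. The product \<open>G\<close> is therefore a Dirichlet series with bounded partial sums of
  coefficients, it is holomorphic and of linear growth for \<open>Re s > 0\<close>, and it has at least the zeros
  of \<open>F\<close>.

  Let \<open>\<alpha> = 1/2 + u/2\<close>. Expanding the square and using that the Fourier transform of the Cauchy
  density is exponential, an Abel summation bounds the integral of
  \<open>\<bar>G (\<alpha> + i t)\<bar>\<^sup>2 / (T\<^sup>2 + t\<^sup>2)\<close> by a constant times \<open>1 / (u T)\<close>.

  For an integer \<open>k\<close> with \<open>\<bar>k\<bar> \<le> T\<close>, divide \<open>G\<close> by the Blaschke product of its zeros in the half plane
  \<open>Re s > \<alpha>\<close> and apply the Poisson formula to the square of the quotient at a point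
  \<open>\<sigma> + i k\<close> where \<open>\<bar>G\<bar>\<close> is bounded below. Each zero with \<open>Re s > 1/2 + u\<close> near height \<open>k\<close> gains a factor
  \<open>exp (c u)\<close>, so \<open>c u\<close> times the number of these zeros is at most the logarithm of a local mean
  square. Summing over \<open>k\<close>, concavity of the logarithm and the mean square bound give the
  total \<open>T ln (1/u)\<close>.
\<close>

subsection \<open>The Poisson formula in a half plane\<close>

lemma integrable_cauchy_weight:
  fixes d k :: real
  assumes "d > 0"
  shows "integrable lborel (\<lambda>t. 1 / (d\<^sup>2 + (t - k)\<^sup>2))"
proof -
  have 1: "integrable lborel (\<lambda>x::real. inverse (1 + x\<^sup>2))"
    using integrable_inverse_1_plus_square by (simp add: set_integrable_def)
  have "integrable lborel (\<lambda>t. (1 + 1 / d\<^sup>2) * inverse (1 + (t - k)\<^sup>2))"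
    using lborel_integrable_real_affine[OF 1, of 1 "-k"] by (simp add: algebra_simps)
  then show ?thesis
  proof (rule Bochner_Integration.integrable_bound)
    show "AE t in lborel. norm (1 / (d\<^sup>2 + (t - k)\<^sup>2)) \<le> norm ((1 + 1 / d\<^sup>2) * inverse (1 + (t - k)\<^sup>2))"
    proof (rule AE_I2)
      fix t :: real
      define x where "x = (t - k)\<^sup>2"
      have "x \<ge> 0" by (simp add: x_def)
      have "1 + x \<le> (1 + 1 / d\<^sup>2) * (d\<^sup>2 + x)"
        using \<open>x \<ge> 0\<close> assms by (simp add: field_simps)
      hence "1 / (d\<^sup>2 + x) \<le> (1 + 1 / d\<^sup>2) * inverse (1 + x)"
        using \<open>x \<ge> 0\<close> assms by (simp add: divide_simps mult.commute add_pos_nonneg)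
      then show "norm (1 / (d\<^sup>2 + (t - k)\<^sup>2)) \<le> norm ((1 + 1 / d\<^sup>2) * inverse (1 + (t - k)\<^sup>2))"
        using \<open>x \<ge> 0\<close> by (simp add: x_def)
    qed
  qed measurable
qed

lemma integrable_times_cauchy_weight:
  fixes h :: "real \<Rightarrow> complex"
  assumes "d > 0" "h \<in> borel_measurable borel" "\<And>t. norm (h t) \<le> M"
  shows "integrable lborel (\<lambda>t. h t / of_real (d\<^sup>2 + (t - k)\<^sup>2))"
proof (rule Bochner_Integration.integrable_bound)
  show "integrable lborel (\<lambda>t. M * (1 / (d\<^sup>2 + (t - k)\<^sup>2)))"
    using integrable_cauchy_weight[OF assms(1)] by (rule integrable_mult_right)
  show "(\<lambda>t. h t / of_real (d\<^sup>2 + (t - k)\<^sup>2)) \<in> borel_measurable lborel"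
    using assms(2) by measurable
  have "M \<ge> 0" using assms(3)[of 0] norm_ge_zero order_trans by blast
  then show "AE t in lborel. norm (h t / of_real (d\<^sup>2 + (t - k)\<^sup>2)) \<le> norm (M * (1 / (d\<^sup>2 + (t - k)\<^sup>2)))"
    using assms(3) by (intro AE_I2) (auto simp: norm_divide simp del: of_real_add of_real_power intro!: divide_right_mono)
qed

text \<open>Cauchy's formula at \<open>d\<close> for \<open>g s / (s + d)\<close>, on the rectangle
  with real parts in \<open>[0, R]\<close> and imaginary parts in \<open>[-R, R]\<close>. On the
  left side \<open>(s + d) * (s - d) = - (d^2 + t^2)\<close>, which produces the Cauchy weight. On
  the other three sides the integrand is \<open>O (1 / R^2)\<close> and the total length is
  \<open>4 * R\<close>, so they vanish as \<open>R\<close> grows.\<close>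

lemma poisson_half_plane_aux:
  fixes g :: "complex \<Rightarrow> complex"
  assumes "e > 0" and hol: "g holomorphic_on {s. Re s > -e}"
    and bd: "\<And>s. Re s \<ge> 0 \<Longrightarrow> norm (g s) \<le> M" and "d > 0"
  shows "(LINT t|lborel. g (Complex 0 t) / of_real (d\<^sup>2 + t\<^sup>2)) = of_real (pi / d) * g (of_real d)"
proof -
  \<comment> \<open>Wide enough to contain the left side of the rectangle, narrow enough to exclude
    the second pole \<open>-d\<close>.\<close>
  define S where "S = {s::complex. Re s > - min e d}"
  define f where "f = (\<lambda>s. g s / (s + of_real d) / (s - of_real d))"
  define h where "h = (\<lambda>t. g (Complex 0 t) / of_real (d\<^sup>2 + t\<^sup>2))"
  have S: "convex S" "open S"
    unfolding S_def by (auto intro: convex_halfspace_Re_gt open_halfspace_Re_gt)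
  have "s + of_real d \<noteq> 0" if "s \<in> S" for s
  proof
    assume "s + of_real d = 0"
    hence "Re s = - d" by (simp add: complex_eq_iff)
    thus False using that by (auto simp: S_def)
  qed
  moreover have "g holomorphic_on S"
    by (rule holomorphic_on_subset[OF hol]) (auto simp: S_def)
  ultimately have hg: "(\<lambda>s. g s / (s + of_real d)) holomorphic_on S"
    by (intro holomorphic_intros) auto
  have fc: "continuous_on A f" if "A \<subseteq> S - {of_real d}" for A
  proof -
    have "continuous_on A (\<lambda>s. g s / (s + of_real d))"
      using hg that holomorphic_on_imp_continuous_on continuous_on_subset by blast
    thus ?thesis unfolding f_def
      by (rule continuous_on_divide) (use that in \<open>auto intro!: continuous_intros\<close>)
  qed
  have M: "M \<ge> 0" using bd[of 0] norm_ge_zero order_trans by (metis order_refl zero_complex.sel(1))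
  \<comment> \<open>The condition \<open>R \<ge> 2 * d\<close> gives
    \<open>|s + d|, |s - d| \<ge> R / 2\<close> on the three outer sides.\<close>
  have *: "norm (integral {-R..R} h - of_real (pi / d) * g (of_real d)) \<le> 16 * M / R"
    if R: "R \<ge> 2 * d" for R
  proof -
    have "R > 0" using R \<open>d > 0\<close> by linarith
    define a1 a2 a3 a4 where "a1 = Complex 0 (-R)" and "a2 = Complex R (-R)"
      and "a3 = Complex R R" and "a4 = Complex 0 R"
    note a = a1_def a2_def a3_def a4_def
    have rp: "rectpath a1 a3 = linepath a1 a2 +++ linepath a2 a3 +++ linepath a3 a4 +++ linepath a4 a1"
      by (simp add: rectpath_def Let_def a)
    have sg: "closed_segment a1 a2 = {z. Im z = -R \<and> Re z \<in> {0..R}}"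
      "closed_segment a2 a3 = {z. Re z = R \<and> Im z \<in> {-R..R}}"
      "closed_segment a3 a4 = {z. Im z = R \<and> Re z \<in> {0..R}}"
      "closed_segment a4 a1 = {z. Re z = 0 \<and> Im z \<in> {-R..R}}"
      using \<open>R > 0\<close>
      by (auto simp: a closed_segment_same_Re closed_segment_same_Im closed_segment_eq_real_ivl)
    have ci: "f contour_integrable_on linepath a1 a2" "f contour_integrable_on linepath a2 a3"
      "f contour_integrable_on linepath a3 a4" "f contour_integrable_on linepath a4 a1"
      by (intro contour_integrable_continuous_linepath fc;
          use \<open>R > 0\<close> \<open>d > 0\<close> \<open>e > 0\<close> R in \<open>force simp: sg S_def\<close>)+
    have "((\<lambda>w. (g w / (w + of_real d)) / (w - of_real d)) has_contour_integral
            (2 * pi * \<i> * winding_number (rectpath a1 a3) (of_real d) * (g (of_real d) / (of_real d + of_real d)))) (rectpath a1 a3)"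
      using S(1) hg
    proof (rule Cauchy_integral_formula_convex_simple)
      show "of_real d \<in> interior S"
        using S(2) \<open>e > 0\<close> \<open>d > 0\<close> by (simp add: interior_open S_def)
      show "path_image (rectpath a1 a3) \<subseteq> S - {of_real d}"
        using \<open>R > 0\<close> \<open>d > 0\<close> \<open>e > 0\<close> R by (auto simp: path_image_rectpath a S_def)
    qed auto
    moreover have "winding_number (rectpath a1 a3) (of_real d) = 1"
      by (rule winding_number_rectpath) (use \<open>R > 0\<close> \<open>d > 0\<close> R in \<open>auto simp: a in_box_complex_iff\<close>)
    ultimately have "contour_integral (rectpath a1 a3) f = 2 * pi * \<i> * (g (of_real d) / (of_real d + of_real d))"
      unfolding f_def by (intro contour_integral_unique) simp
    also have "\<dots> = \<i> * (of_real (pi / d) * g (of_real d))"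
      using \<open>d > 0\<close> by (simp add: field_simps)
    finally have tot: "contour_integral (rectpath a1 a3) f = \<i> * (of_real (pi / d) * g (of_real d))" .
    have "contour_integral (rectpath a1 a3) f = contour_integral (linepath a1 a2) f +
        (contour_integral (linepath a2 a3) f + (contour_integral (linepath a3 a4) f + contour_integral (linepath a4 a1) f))"
      unfolding rp using ci by (simp add: contour_integral_join contour_integrable_join valid_path_join)
    moreover have "contour_integral (linepath a4 a1) f = \<i> * integral {-R..R} h"
    proof -
      have "contour_integral (linepath a4 a1) f = - contour_integral (linepath a1 a4) f"
        by (metis contour_integral_reversepath reversepath_linepath valid_path_linepath)
      also have "contour_integral (linepath a1 a4) f = \<i> * integral {-R..R} (\<lambda>x. f (Complex 0 x))"
        by (rule contour_integral_linepath_same_Re) (use \<open>R > 0\<close> in \<open>auto simp: a\<close>)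
      also have "(\<lambda>x. f (Complex 0 x)) = (\<lambda>x. - h x)"
      proof
        fix x
        have "(Complex 0 x + of_real d) * (Complex 0 x - of_real d) = - of_real (d\<^sup>2 + x\<^sup>2)"
          by (simp add: complex_eq_iff power2_eq_square)
        thus "f (Complex 0 x) = - h x"
          unfolding f_def h_def by (metis divide_divide_eq_left divide_minus_right)
      qed
      finally show ?thesis by simp
    qed
    moreover have bnd: "norm (contour_integral (linepath p q) f) \<le> 4 * M / R\<^sup>2 * norm (q - p)"
      if "f contour_integrable_on linepath p q" "\<And>s. s \<in> closed_segment p q \<Longrightarrow> Re s \<ge> 0 \<and> norm s \<ge> R" for p q
      using that(1)
    proof (rule contour_integral_bound_linepath)
      show "0 \<le> 4 * M / R\<^sup>2" using M by simp
      fix s assume "s \<in> closed_segment p q"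
      with that(2) have s: "Re s \<ge> 0" "norm s \<ge> R" by auto
      have "norm s \<le> norm (s + of_real d) + d" "norm s \<le> norm (s - of_real d) + d"
        using norm_triangle_ineq4[of "s + of_real d" "of_real d"] norm_triangle_ineq[of "s - of_real d" "of_real d"] \<open>d > 0\<close>
        by auto
      hence "norm (s + of_real d) \<ge> R / 2" "norm (s - of_real d) \<ge> R / 2" using s R by linarith+
      hence "norm (s + of_real d) * norm (s - of_real d) \<ge> R / 2 * (R / 2)"
        using \<open>R > 0\<close> by (intro mult_mono) auto
      hence "norm (f s) \<le> M / (R / 2 * (R / 2))"
        unfolding f_def divide_divide_eq_left norm_divide norm_mult
        using bd[OF s(1)] \<open>R > 0\<close> M by (intro frac_le) auto
      thus "norm (f s) \<le> 4 * M / R\<^sup>2" by (simp add: power2_eq_square field_simps)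
    qed
    ultimately have "\<i> * (integral {-R..R} h - of_real (pi / d) * g (of_real d)) =
       - (contour_integral (linepath a1 a2) f + contour_integral (linepath a2 a3) f + contour_integral (linepath a3 a4) f)"
      using tot by (simp add: algebra_simps)
    hence "norm (integral {-R..R} h - of_real (pi / d) * g (of_real d)) =
       norm (contour_integral (linepath a1 a2) f + contour_integral (linepath a2 a3) f + contour_integral (linepath a3 a4) f)"
      by (metis norm_minus_cancel norm_mult norm_ii mult_1)
    also have "\<dots> \<le> norm (contour_integral (linepath a1 a2) f) + norm (contour_integral (linepath a2 a3) f) + norm (contour_integral (linepath a3 a4) f)"
      by (meson norm_triangle_mono norm_triangle_ineq order_refl)
    also have "\<dots> \<le> 4 * M / R\<^sup>2 * norm (a2 - a1) + 4 * M / R\<^sup>2 * norm (a3 - a2) + 4 * M / R\<^sup>2 * norm (a4 - a3)"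
    proof -
      have r: "norm s \<ge> R" if "\<bar>Re s\<bar> = R \<or> \<bar>Im s\<bar> = R" for s
        using that abs_Re_le_cmod[of s] abs_Im_le_cmod[of s] by auto
      show ?thesis
        by (intro add_mono bnd ci) (use \<open>R > 0\<close> in \<open>auto simp: sg intro!: r\<close>)
    qed
    also have "\<dots> = 16 * M / R"
    proof -
      have "a2 - a1 = of_real R" "a3 - a2 = of_real (2 * R) * \<i>" "a4 - a3 = - of_real R"
        by (auto simp: a complex_eq_iff)
      hence "norm (a2 - a1) = R" "norm (a3 - a2) = 2 * R" "norm (a4 - a3) = R"
        using \<open>R > 0\<close> by (auto simp: norm_mult)
      thus ?thesis using \<open>R > 0\<close> by (simp add: power2_eq_square field_simps)
    qed
    finally show ?thesis .
  qed
  have gc: "continuous_on UNIV (\<lambda>t. g (Complex 0 t))"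
    by (rule continuous_on_compose2[OF holomorphic_on_imp_continuous_on[OF hol]])
       (use \<open>e > 0\<close> in \<open>auto intro!: continuous_intros\<close>)
  have hi: "integrable lborel h"
    using integrable_times_cauchy_weight[of d "\<lambda>t. g (Complex 0 t)" M 0] borel_measurable_continuous_onI[OF gc] bd \<open>d > 0\<close>
    by (simp add: h_def)
  have lim1: "(\<lambda>n. integral {- real n..real n} h) \<longlonglongrightarrow> (LINT t|lborel. h t)"
  proof -
    have eq: "integral {- real n..real n} h = (LINT t|lborel. indicator {- real n..real n} t *\<^sub>R h t)" for n
    proof -
      have "set_integrable lborel {- real n..real n} h"
        unfolding set_integrable_def using hi by (rule integrable_mult_indicator[rotated]) auto
      thus ?thesis using set_borel_integral_eq_integral(2) by (metis set_lebesgue_integral_def)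
    qed
    show ?thesis unfolding eq
    proof (rule integral_dominated_convergence[where w = "\<lambda>t. norm (h t)"])
      show "AE t in lborel. (\<lambda>n. indicator {- real n..real n} t *\<^sub>R h t) \<longlonglongrightarrow> h t"
      proof (rule AE_I2)
        fix t :: real
        have "eventually (\<lambda>n. indicator {- real n..real n} t *\<^sub>R h t = h t) sequentially"
          using eventually_ge_at_top[of "nat \<lceil>\<bar>t\<bar>\<rceil>"]
          by eventually_elim (auto simp: indicator_def nat_le_iff ceiling_le_iff)
        thus "(\<lambda>n. indicator {- real n..real n} t *\<^sub>R h t) \<longlonglongrightarrow> h t"
          by (simp add: tendsto_eventually)
      qed
    qed (use hi in \<open>auto simp: indicator_def\<close>)
  qed
  have lim2: "(\<lambda>n. integral {- real n..real n} h) \<longlonglongrightarrow> of_real (pi / d) * g (of_real d)"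
  proof (rule LIM_zero_cancel, rule Lim_null_comparison)
    show "eventually (\<lambda>n. norm (integral {- real n..real n} h - of_real (pi / d) * g (of_real d)) \<le> 16 * M / real n) sequentially"
      using eventually_ge_at_top[of "nat \<lceil>2 * d\<rceil>"]
      by eventually_elim (rule *, simp add: nat_le_iff ceiling_le_iff)
    show "(\<lambda>n. 16 * M / real n) \<longlonglongrightarrow> 0"
      by real_asymp
  qed
  show ?thesis using LIMSEQ_unique[OF lim1 lim2] by (simp add: h_def)
qed

text \<open>Translation by \<open>Complex \<alpha> k\<close> moves the line
  \<open>Re s = \<alpha>\<close> to the imaginary axis and the evaluation point to the real
  axis.\<close>

lemma poisson_half_plane:
  fixes g :: "complex \<Rightarrow> complex"
  assumes "c < \<alpha>" and hol: "g holomorphic_on {s. Re s > c}"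
    and bd: "\<And>s. Re s \<ge> \<alpha> \<Longrightarrow> norm (g s) \<le> M" and "d > 0"
  shows "(LINT t|lborel. g (Complex \<alpha> t) / of_real (d\<^sup>2 + (t - k)\<^sup>2)) = of_real (pi / d) * g (Complex (\<alpha> + d) k)"
proof -
  define g' where "g' = (\<lambda>s. g (Complex \<alpha> k + s))"
  have "(LINT t|lborel. g' (Complex 0 t) / of_real (d\<^sup>2 + t\<^sup>2)) = of_real (pi / d) * g' (of_real d)"
  proof (rule poisson_half_plane_aux[where e = "\<alpha> - c" and M = M])
    show "g' holomorphic_on {s. - (\<alpha> - c) < Re s}"
    proof -
      have "(\<lambda>s. Complex \<alpha> k + s) holomorphic_on {s. - (\<alpha> - c) < Re s}"
        by (intro holomorphic_intros)
      from holomorphic_on_compose_gen[OF this hol] show ?thesis by (simp add: o_def g'_def image_subset_iff)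
    qed
  qed (use assms in \<open>auto simp: g'_def\<close>)
  also have "Complex \<alpha> k + of_real d = Complex (\<alpha> + d) k" by (simp add: complex_eq_iff)
  hence "g' (of_real d) = g (Complex (\<alpha> + d) k)" by (simp add: g'_def)
  also have "(LINT t|lborel. g' (Complex 0 t) / of_real (d\<^sup>2 + t\<^sup>2)) =
    (LINT t|lborel. g (Complex \<alpha> t) / of_real (d\<^sup>2 + (t - k)\<^sup>2))"
  proof -
    have "Complex \<alpha> k + Complex 0 t = Complex \<alpha> (k + 1 * t)" for t by (simp add: complex_eq_iff)
    thus ?thesis
      using lborel_integral_real_affine[of 1 "\<lambda>t. g (Complex \<alpha> t) / of_real (d\<^sup>2 + (t - k)\<^sup>2)" k]
      by (simp add: g'_def)
  qed
  finally show "(LINT t|lborel. g (Complex \<alpha> t) / of_real (d\<^sup>2 + (t - k)\<^sup>2)) = of_real (pi / d) * g (Complex (\<alpha> + d) k)" .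
qed

text \<open>The Poisson formula for \<open>exp (- y * s)\<close>, which is bounded in the right half
  plane when \<open>y \<ge> 0\<close>. This gives the case \<open>x \<le> 0\<close>; the other sign
  follows by conjugation.\<close>

lemma integral_cis_cauchy_weight:
  fixes x T :: real
  assumes "T > 0"
  shows "integrable lborel (\<lambda>t. cis (x * t) / of_real (T\<^sup>2 + t\<^sup>2))"
    and "(LINT t|lborel. cis (x * t) / of_real (T\<^sup>2 + t\<^sup>2)) = of_real (pi / T * exp (- T * \<bar>x\<bar>))"
proof -
  have cis: "exp (- of_real y * Complex 0 t) = cis (- y * t)" for y t
  proof -
    have "- of_real y * Complex 0 t = \<i> * of_real (- y * t)" by (simp add: complex_eq_iff)
    thus ?thesis by (simp only: cis_conv_exp)
  qed
  have neg: "(LINT t|lborel. cis (- y * t) / of_real (T\<^sup>2 + t\<^sup>2)) = of_real (pi / T * exp (- T * y))" if "y \<ge> 0" for y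
  proof -
    have hol: "(\<lambda>s. exp (- of_real y * s)) holomorphic_on {s. Re s > -1}"
      by (intro holomorphic_intros)
    have bd: "norm (exp (- of_real y * s)) \<le> 1" if "Re s \<ge> 0" for s
      using that \<open>y \<ge> 0\<close> by simp
    have "exp (- (complex_of_real y * Complex T 0)) = of_real (exp (- T * y))"
    proof -
      have "- (complex_of_real y * Complex T 0) = of_real (- T * y)" by (simp add: complex_eq_iff)
      thus ?thesis by (simp only: exp_of_real)
    qed
    thus ?thesis
      using poisson_half_plane[of "-1" 0 _ 1 T 0, OF _ hol bd \<open>T > 0\<close>]
      unfolding cis by simp
  qed
  show "integrable lborel (\<lambda>t. cis (x * t) / of_real (T\<^sup>2 + t\<^sup>2))"
    using integrable_times_cauchy_weight[of T "\<lambda>t. cis (x * t)" 1 0] \<open>T > 0\<close>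
      borel_measurable_continuous_onI[of "\<lambda>t. cis (x * t)"] by (simp add: continuous_intros)
  show "(LINT t|lborel. cis (x * t) / of_real (T\<^sup>2 + t\<^sup>2)) = of_real (pi / T * exp (- T * \<bar>x\<bar>))"
  proof (cases "x \<le> 0")
    case True
    thus ?thesis using neg[of "-x"] by simp
  next
    case False
    have "(LINT t|lborel. cis (x * t) / of_real (T\<^sup>2 + t\<^sup>2)) = (LINT t|lborel. cnj (cis (- x * t) / of_real (T\<^sup>2 + t\<^sup>2)))"
      by (simp add: cis_cnj)
    also have "\<dots> = cnj (LINT t|lborel. cis (- x * t) / of_real (T\<^sup>2 + t\<^sup>2))"
      by (rule Bochner_Integration.integral_cnj)
    finally show ?thesis using neg[of x] False by simp
  qed
qed

subsection \<open>Mean squares of Dirichlet series\<close>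

text \<open>Abel summation. The difference between \<open>w N * B N\<close> and the weighted sum
  collects the increments of \<open>w\<close> times partial sums of \<open>b\<close>. As
  \<open>w\<close> is non-negative and increasing, these increments add up to at most
  \<open>w N\<close>.\<close>

lemma norm_sum_monotone_weight_le:
  fixes b :: "nat \<Rightarrow> complex" and w :: "nat \<Rightarrow> real"
  assumes bd: "\<And>N. norm (\<Sum>n=1..N. b n) \<le> M"
    and w: "\<And>n. n \<ge> 1 \<Longrightarrow> 0 \<le> w n" "\<And>n. n \<ge> 1 \<Longrightarrow> w n \<le> w (Suc n)" and "N \<ge> 1"
  shows "norm (\<Sum>n=1..N. of_real (w n) * b n) \<le> 2 * M * w N"
proof -
  have M: "M \<ge> 0" using bd[of 0] by simp
  define B where "B = (\<lambda>N. \<Sum>n=1..N. b n)"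
  have "norm (of_real (w N) * B N - (\<Sum>n=1..N. of_real (w n) * b n)) \<le> M * w N"
    using \<open>N \<ge> 1\<close>
  proof (induction N rule: dec_induct)
    case base
    show ?case using M w(1)[of 1] by (simp add: B_def)
  next
    case (step N)
    have "of_real (w (Suc N)) * B (Suc N) - (\<Sum>n=1..Suc N. of_real (w n) * b n)
       = (of_real (w N) * B N - (\<Sum>n=1..N. of_real (w n) * b n)) + of_real (w (Suc N) - w N) * B N"
      using step by (simp add: B_def algebra_simps)
    also have "norm \<dots> \<le> M * w N + (w (Suc N) - w N) * M"
    proof (rule norm_triangle_mono)
      show "norm (of_real (w (Suc N) - w N) * B N) \<le> (w (Suc N) - w N) * M"
        using w(2)[of N] step bd[of N] unfolding norm_mult norm_of_real by (intro mult_mono) (auto simp: B_def)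
    qed (use step in auto)
    finally show ?case by (simp add: algebra_simps)
  qed
  moreover have "norm (of_real (w N) * B N) \<le> w N * M"
    using w(1)[of N] \<open>N \<ge> 1\<close> bd[of N] unfolding norm_mult norm_of_real by (intro mult_mono) (auto simp: B_def)
  moreover have "norm (\<Sum>n=1..N. of_real (w n) * b n) \<le> norm (of_real (w N) * B N)
      + norm (of_real (w N) * B N - (\<Sum>n=1..N. of_real (w n) * b n))"
    by (metis norm_triangle_sub norm_minus_commute)
  ultimately show ?thesis by argo
qed

text \<open>A discrete integral comparison: \<open>x powr (-u) / u\<close> decreases from
  \<open>x\<close> to \<open>x + 1\<close> by at least \<open>(x + 1) powr (-1-u)\<close>.
  Subtracting \<open>N powr (-u) / u\<close> from the bound makes the induction telescope.\<close>

lemma sum_powr_le: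
  fixes u :: real
  assumes "u > 0"
  shows "(\<Sum>j=1..N. real j powr (-1-u)) \<le> 1 + 1 / u"
proof -
  have "(\<Sum>j=1..N. real j powr (-1-u)) \<le> 1 + 1 / u - real N powr (-u) / u" if "N \<ge> 1"
    using that
  proof (induction N rule: dec_induct)
    case base
    show ?case by simp
  next
    case (step N)
    define x where "x = real N"
    have x: "x \<ge> 1" using step by (simp add: x_def)
    \<comment> \<open>This is the required decrease of \<open>x powr (-u) / u\<close>, divided by
      \<open>(x + 1) powr (-u) / u\<close>.\<close>
    have "1 + u / (x + 1) \<le> ((x + 1) / x) powr u"
    proof -
      have "ln (x / (x + 1)) \<le> x / (x + 1) - 1" using x by (intro ln_le_minus_one) auto
      hence "1 / (x + 1) \<le> ln ((x + 1) / x)" using x by (simp add: ln_div field_simps)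
      hence "u / (x + 1) \<le> u * ln ((x + 1) / x)" using assms mult_left_mono[of "1 / (x + 1)" _ u] by simp
      also have "1 + \<dots> \<le> exp (u * ln ((x + 1) / x))" by (rule exp_ge_add_one_self)
      finally show ?thesis using x by (simp add: powr_def)
    qed
    also have "((x + 1) / x) powr u = x powr (-u) / (x + 1) powr (-u)"
      using x by (simp add: powr_divide powr_minus field_simps)
    finally have "(1 + u / (x + 1)) * (x + 1) powr (-u) \<le> x powr (-u)"
      using x by (simp add: field_simps)
    hence "(1 + u / (x + 1)) * (x + 1) powr (-u) / u \<le> x powr (-u) / u"
      using assms by (intro divide_right_mono) auto
    moreover have "(x + 1) powr (-1-u) = (x + 1) powr (-u) / (x + 1)"
      using x by (simp add: powr_diff powr_minus field_simps)
    moreover have "(1 + u / (x + 1)) * A / u = A / (x + 1) + A / u" for A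
      using assms x by (simp add: field_simps)
    ultimately have "(x + 1) powr (-1-u) + (x + 1) powr (-u) / u \<le> x powr (-u) / u"
      by simp
    thus ?case using step by (simp add: x_def add.commute)
  qed
  moreover have "real N powr (-u) / u \<ge> 0" using assms by simp
  ultimately show ?thesis
  proof (cases "N \<ge> 1")
    case False
    thus ?thesis using assms by (simp add: not_le)
  qed linarith
qed

text \<open>The kernel is \<open>(min m n / max m n) powr T\<close>. Writing \<open>V j\<close> for the \<open>j\<close>-th term on the right,
  the step from \<open>N\<close> to \<open>N + 1\<close> adds \<open>V (N + 1) - \<bar>S N\<bar>\<^sup>2 (N + 1) powr (-2 T)\<close> to the form.\<close>

lemma quadratic_form_le:
  fixes c :: "nat \<Rightarrow> complex" and T :: real
  defines "S \<equiv> (\<lambda>N. \<Sum>n=1..N. c n * of_real (real n powr T))"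
  assumes "T \<ge> 0"
  shows "Re (\<Sum>m=1..N. \<Sum>n=1..N. c m * cnj (c n) * of_real (exp (- T * \<bar>ln (real n) - ln (real m)\<bar>)))
         \<le> (\<Sum>j=1..N. real j powr (-2 * T) * (norm (S j))\<^sup>2)"
proof (induction N)
  case 0
  show ?case by simp
next
  case (Suc N)
  define E where "E = (\<lambda>m n::nat. exp (- T * \<bar>ln (real n) - ln (real m)\<bar>))"
  define x where "x = real (Suc N) powr T"
  have x: "x > 0" by (simp add: x_def)
  have E: "E n (Suc N) = real n powr T / x" "E (Suc N) n = real n powr T / x" if "n \<in> {1..Suc N}" for n
  proof -
    have "E n (Suc N) = exp (T * ln (real n) - T * ln (real (Suc N)))"
      unfolding E_def using that by (auto simp: abs_if algebra_simps)
    also have "\<dots> = real n powr T / x"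
      unfolding exp_diff x_def powr_def using that by auto
    finally show "E n (Suc N) = real n powr T / x" .
    thus "E (Suc N) n = real n powr T / x" by (simp add: E_def abs_minus_commute)
  qed
  define C where "C = c (Suc N)"
  have "(\<Sum>m=1..Suc N. \<Sum>n=1..Suc N. c m * cnj (c n) * of_real (E m n))
      = (\<Sum>m=1..N. \<Sum>n=1..N. c m * cnj (c n) * of_real (E m n))
        + (\<Sum>m=1..N. c m * cnj C * of_real (E m (Suc N)))
        + (\<Sum>n=1..N. C * cnj (c n) * of_real (E (Suc N) n)) + C * cnj C * of_real (E (Suc N) (Suc N))"
    by (simp add: sum.distrib C_def)
  also have "(\<Sum>m=1..N. c m * cnj C * of_real (E m (Suc N))) = cnj C / x * S N"
    unfolding S_def sum_distrib_left by (intro sum.cong) (auto simp: E)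
  also have "(\<Sum>n=1..N. C * cnj (c n) * of_real (E (Suc N) n)) = C / x * cnj (S N)"
    unfolding S_def sum_distrib_left cnj_sum by (intro sum.cong) (auto simp: E)
  also have "E (Suc N) (Suc N) = 1" by (simp add: E_def)
  finally have "Re (\<Sum>m=1..Suc N. \<Sum>n=1..Suc N. c m * cnj (c n) * of_real (E m n)) =
     Re (\<Sum>m=1..N. \<Sum>n=1..N. c m * cnj (c n) * of_real (E m n)) +
     Re (cnj C / x * S N + C / x * cnj (S N) + C * cnj C)"
    by simp
  also have "Re (cnj C / x * S N + C / x * cnj (S N) + C * cnj C) \<le> (norm (S N / of_real x + C))\<^sup>2"
  proof -
    have "(norm (S N / of_real x + C))\<^sup>2 = Re ((S N / of_real x + C) * cnj (S N / of_real x + C))"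
      by (simp only: complex_norm_square[symmetric] Re_complex_of_real)
    also have "(S N / of_real x + C) * cnj (S N / of_real x + C) =
       (S N / of_real x) * cnj (S N / of_real x) + (cnj C / x * S N + C / x * cnj (S N) + C * cnj C)"
      by (simp add: algebra_simps)
    also have "Re \<dots> = (norm (S N / of_real x))\<^sup>2 + Re (cnj C / x * S N + C / x * cnj (S N) + C * cnj C)"
      by (simp only: complex_norm_square[symmetric] plus_complex.sel Re_complex_of_real)
    finally show ?thesis by simp
  qed
  also have "S N / of_real x + C = S (Suc N) / of_real x"
    using x by (simp add: S_def C_def x_def add_divide_distrib)
  also have "(norm (S (Suc N) / of_real x))\<^sup>2 = real (Suc N) powr (- 2 * T) * (norm (S (Suc N)))\<^sup>2"
  proof -
    have "x\<^sup>2 = real (Suc N) powr (2 * T)"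
      unfolding x_def power2_eq_square by (simp flip: powr_add)
    thus ?thesis using x by (simp add: norm_divide power_divide powr_minus field_simps)
  qed
  finally show ?case using Suc by (simp add: E_def)
qed

text \<open>Expanding the square gives cross terms \<open>cis ((ln n - ln m) * t)\<close>. Their
  integrals against the Cauchy weight are exponentials of \<open>- T * |ln n - ln m|\<close>, so the
  mean square is exactly the quadratic form bounded above.\<close>

lemma mean_square_dirichlet_polynomial:
  fixes c :: "nat \<Rightarrow> complex" and T :: real and N :: nat
  defines "D \<equiv> (\<lambda>t. \<Sum>n=1..N. c n * cis (- t * ln (real n)))"
  assumes T: "T > 0"
  shows "integrable lborel (\<lambda>t. (norm (D t))\<^sup>2 / (T\<^sup>2 + t\<^sup>2))"
    and "(LINT t|lborel. (norm (D t))\<^sup>2 / (T\<^sup>2 + t\<^sup>2)) \<le>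
      pi / T * (\<Sum>j=1..N. real j powr (-2 * T) * (norm (\<Sum>n=1..j. c n * of_real (real n powr T)))\<^sup>2)"
proof -
  define K where "K = (\<lambda>m n t. cis ((ln (real n) - ln (real m)) * t) / of_real (T\<^sup>2 + t\<^sup>2))"
  have eq: "of_real ((norm (D t))\<^sup>2 / (T\<^sup>2 + t\<^sup>2)) =
     (\<Sum>m=1..N. \<Sum>n=1..N. c m * cnj (c n) * K m n t)" for t
  proof -
    have "of_real ((norm (D t))\<^sup>2 / (T\<^sup>2 + t\<^sup>2)) = D t * cnj (D t) / of_real (T\<^sup>2 + t\<^sup>2)"
      by (simp add: complex_norm_square[symmetric])
    also have "D t * cnj (D t) = (\<Sum>m=1..N. \<Sum>n=1..N. c m * cnj (c n) * cis ((ln (real n) - ln (real m)) * t))"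
      unfolding D_def cnj_sum sum_product
      by (intro sum.cong refl) (simp add: cis_cnj cis_mult algebra_simps)
    finally show ?thesis by (simp add: sum_divide_distrib K_def)
  qed
  have Ki: "integrable lborel (K m n)" for m n
    unfolding K_def by (rule integral_cis_cauchy_weight[OF T])
  have i: "integrable lborel (\<lambda>t. complex_of_real ((norm (D t))\<^sup>2 / (T\<^sup>2 + t\<^sup>2)))"
    unfolding eq by (intro Bochner_Integration.integrable_sum integrable_mult_right Ki)
  thus "integrable lborel (\<lambda>t. (norm (D t))\<^sup>2 / (T\<^sup>2 + t\<^sup>2))"
    using complex_of_real_integrable_eq by blast
  have "(LINT t|lborel. (norm (D t))\<^sup>2 / (T\<^sup>2 + t\<^sup>2)) = Re (LINT t|lborel. complex_of_real ((norm (D t))\<^sup>2 / (T\<^sup>2 + t\<^sup>2)))"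
    by (simp only: integral_complex_of_real Re_complex_of_real)
  also have "(LINT t|lborel. complex_of_real ((norm (D t))\<^sup>2 / (T\<^sup>2 + t\<^sup>2))) =
     (\<Sum>m=1..N. \<Sum>n=1..N. c m * cnj (c n) * of_real (pi / T * exp (- T * \<bar>ln (real n) - ln (real m)\<bar>)))"
    unfolding eq
    by (subst Bochner_Integration.integral_sum, intro Bochner_Integration.integrable_sum integrable_mult_right Ki,
        intro sum.cong refl, subst Bochner_Integration.integral_sum, intro integrable_mult_right Ki,
        intro sum.cong refl, subst integral_mult_right_zero)
       (simp only: K_def integral_cis_cauchy_weight(2)[OF T])
  also have "\<dots> = of_real (pi / T) * (\<Sum>m=1..N. \<Sum>n=1..N. c m * cnj (c n) * of_real (exp (- T * \<bar>ln (real n) - ln (real m)\<bar>)))"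
    unfolding sum_distrib_left by (intro sum.cong refl) (simp add: mult_ac)
  also have "Re \<dots> = pi / T * Re (\<Sum>m=1..N. \<Sum>n=1..N. c m * cnj (c n) * of_real (exp (- T * \<bar>ln (real n) - ln (real m)\<bar>)))"
    by simp
  also have "\<dots> \<le> pi / T * (\<Sum>j=1..N. real j powr (-2 * T) * (norm (\<Sum>n=1..j. c n * of_real (real n powr T)))\<^sup>2)"
    using T by (intro mult_left_mono quadratic_form_le) auto
  finally show "(LINT t|lborel. (norm (D t))\<^sup>2 / (T\<^sup>2 + t\<^sup>2)) \<le>
      pi / T * (\<Sum>j=1..N. real j powr (-2 * T) * (norm (\<Sum>n=1..j. c n * of_real (real n powr T)))\<^sup>2)" .
qed

text \<open>With \<open>c n = b n * n powr (-\<alpha>)\<close>, the inner sums of the polynomial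
  bound carry the weights \<open>n powr (T - \<alpha>)\<close>, which increase because
  \<open>T \<ge> \<alpha>\<close>. Abel summation bounds them by
  \<open>2 * M * j powr (T - \<alpha>)\<close>, and after squaring, the powers of \<open>T\<close>
  cancel and leave \<open>j powr (-2 * \<alpha>) = j powr (-1 - u)\<close>. The resulting bound is
  uniform in the length of the polynomial.\<close>

lemma mean_square_dirichlet_series:
  fixes b :: "nat \<Rightarrow> complex" and T u :: real and g :: "real \<Rightarrow> complex"
  defines "\<alpha> \<equiv> 1 / 2 + u / 2"
  assumes bd: "\<And>N. norm (\<Sum>n=1..N. b n) \<le> M" and u: "u > 0" and T: "T \<ge> \<alpha>"
    and lim: "\<And>t. (\<lambda>N. \<Sum>n=1..N. b n * of_nat n powr (- Complex \<alpha> t)) \<longlonglongrightarrow> g t"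
  shows "integrable lborel (\<lambda>t. (norm (g t))\<^sup>2 / (T\<^sup>2 + t\<^sup>2))" (is ?A)
    and "(LINT t|lborel. (norm (g t))\<^sup>2 / (T\<^sup>2 + t\<^sup>2)) \<le> 4 * pi * M\<^sup>2 * (1 + 1 / u) / T" (is ?B)
proof -
  define c where "c = (\<lambda>n. b n * of_real (real n powr (-\<alpha>)))"
  define D where "D = (\<lambda>N t. \<Sum>n=1..N. c n * cis (- t * ln (real n)))"
  define K where "K = 4 * pi * M\<^sup>2 * (1 + 1 / u) / T"
  have T0: "T > 0" using T u unfolding \<alpha>_def by linarith
  have M: "M \<ge> 0" using bd[of 0] by simp
  have K: "K \<ge> 0" using u T0 by (simp add: K_def)
  have lim': "(\<lambda>N. D N t) \<longlonglongrightarrow> g t" for t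
  proof -
    have "c n * cis (- t * ln (real n)) = b n * of_nat n powr (- Complex \<alpha> t)" if "n \<ge> 1" for n
    proof -
      have "of_nat n powr (- Complex \<alpha> t) = exp (- Complex \<alpha> t * of_real (ln (real n)))"
        using that by (simp add: powr_def Ln_of_nat)
      also have "\<dots> = of_real (real n powr (-\<alpha>)) * cis (- t * ln (real n))"
        using that by (simp add: exp_eq_polar powr_def)
      finally show ?thesis by (simp add: c_def)
    qed
    thus ?thesis using lim[of t] unfolding D_def by simp
  qed
  have DK: "(LINT t|lborel. (norm (D N t))\<^sup>2 / (T\<^sup>2 + t\<^sup>2)) \<le> K" for N
  proof -
    have "(LINT t|lborel. (norm (D N t))\<^sup>2 / (T\<^sup>2 + t\<^sup>2)) \<le>
       pi / T * (\<Sum>j=1..N. real j powr (-2 * T) * (norm (\<Sum>n=1..j. c n * of_real (real n powr T)))\<^sup>2)"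
      unfolding D_def by (rule mean_square_dirichlet_polynomial(2)[OF T0])
    also have "(\<Sum>j=1..N. real j powr (-2 * T) * (norm (\<Sum>n=1..j. c n * of_real (real n powr T)))\<^sup>2)
      \<le> (\<Sum>j=1..N. 4 * M\<^sup>2 * real j powr (-1 - u))"
    proof (rule sum_mono)
      fix j assume j: "j \<in> {1..N}"
      have "(\<Sum>n=1..j. c n * of_real (real n powr T)) = (\<Sum>n=1..j. of_real (real n powr (T - \<alpha>)) * b n)"
        by (intro sum.cong) (auto simp: c_def powr_diff powr_minus field_simps)
      also have "norm \<dots> \<le> 2 * M * real j powr (T - \<alpha>)"
        using j T by (intro norm_sum_monotone_weight_le bd powr_mono2) auto
      finally have "real j powr (-2 * T) * (norm (\<Sum>n=1..j. c n * of_real (real n powr T)))\<^sup>2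
        \<le> real j powr (-2 * T) * (2 * M * real j powr (T - \<alpha>))\<^sup>2"
        by (intro mult_left_mono power_mono) auto
      also have "\<dots> = 4 * M\<^sup>2 * (real j powr (-2 * T) * real j powr (T - \<alpha>) * real j powr (T - \<alpha>))"
        by (simp add: power2_eq_square)
      also have "real j powr (-2 * T) * real j powr (T - \<alpha>) * real j powr (T - \<alpha>) = real j powr (-1 - u)"
      proof -
        have "- 2 * T + (T - \<alpha>) + (T - \<alpha>) = - 1 - u" by (simp add: \<alpha>_def field_simps)
        thus ?thesis by (metis powr_add)
      qed
      finally show "real j powr (-2 * T) * (norm (\<Sum>n=1..j. c n * of_real (real n powr T)))\<^sup>2
         \<le> 4 * M\<^sup>2 * real j powr (-1 - u)" .
    qed
    also have "\<dots> \<le> 4 * M\<^sup>2 * (1 + 1 / u)"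
      unfolding sum_distrib_left[symmetric] by (intro mult_left_mono sum_powr_le u) auto
    finally show ?thesis using T0 by (simp add: K_def mult_left_mono divide_right_mono field_simps)
  qed
  have Dm[measurable]: "D N \<in> borel_measurable borel" for N
    unfolding D_def by (intro borel_measurable_continuous_onI continuous_intros)
  have gm[measurable]: "g \<in> borel_measurable borel"
    by (rule borel_measurable_LIMSEQ_metric[OF Dm lim'])
  have nn: "(\<integral>\<^sup>+t. ennreal ((norm (D N t))\<^sup>2 / (T\<^sup>2 + t\<^sup>2)) \<partial>lborel) \<le> ennreal K" for N
  proof -
    have "integrable lborel (\<lambda>t. (norm (D N t))\<^sup>2 / (T\<^sup>2 + t\<^sup>2))"
      unfolding D_def by (rule mean_square_dirichlet_polynomial(1)[OF T0])
    thus ?thesis using DK[of N] by (subst nn_integral_eq_integral) (auto intro: ennreal_leI)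
  qed
  have liminf: "(\<lambda>N. ennreal ((norm (D N t))\<^sup>2 / (T\<^sup>2 + t\<^sup>2))) \<longlonglongrightarrow> ennreal ((norm (g t))\<^sup>2 / (T\<^sup>2 + t\<^sup>2))" for t
    using T0 by (intro tendsto_ennrealI tendsto_intros lim') (auto simp: add_pos_nonneg pos_add_strict add_nonneg_eq_0_iff)
  \<comment> \<open>Fatou's lemma: pointwise convergence of \<open>D N\<close> and the uniform bound
    \<open>K\<close> suffice to pass to the limit.\<close>
  have "(\<integral>\<^sup>+t. ennreal ((norm (g t))\<^sup>2 / (T\<^sup>2 + t\<^sup>2)) \<partial>lborel)
     = (\<integral>\<^sup>+t. liminf (\<lambda>N. ennreal ((norm (D N t))\<^sup>2 / (T\<^sup>2 + t\<^sup>2))) \<partial>lborel)"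
    by (intro nn_integral_cong lim_imp_Liminf[symmetric] liminf) simp
  also have "\<dots> \<le> liminf (\<lambda>N. \<integral>\<^sup>+t. ennreal ((norm (D N t))\<^sup>2 / (T\<^sup>2 + t\<^sup>2)) \<partial>lborel)"
    by (intro nn_integral_liminf) measurable
  also have "\<dots> \<le> limsup (\<lambda>N. \<integral>\<^sup>+t. ennreal ((norm (D N t))\<^sup>2 / (T\<^sup>2 + t\<^sup>2)) \<partial>lborel)"
    by (rule Liminf_le_Limsup) simp
  also have "\<dots> \<le> ennreal K"
    by (rule Limsup_bounded) (simp add: nn)
  finally have fin: "(\<integral>\<^sup>+t. ennreal ((norm (g t))\<^sup>2 / (T\<^sup>2 + t\<^sup>2)) \<partial>lborel) \<le> ennreal K" .
  show A: ?A
    by (rule integrableI_nonneg) (use fin in \<open>auto intro: le_less_trans\<close>)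
  show ?B
    using fin K nn_integral_eq_integral[OF A] by (simp add: K_def)
qed

subsection \<open>A Jensen inequality in a half plane\<close>

text \<open>The factors are divided out one point at a time; near \<open>\<rho>\<close> the quotient
  is the local cofactor \<open>h\<close> over the remaining product, which does not vanish there.
  Since \<open>h \<rho> = 0\<close> is allowed, \<open>m \<rho>\<close> can be smaller than the
  order of \<open>f\<close>, as happens where a zero of \<open>F\<close> meets one of
  \<open>1 - 2 powr (1 - s)\<close>.\<close>

lemma holomorphic_factor_zeros:
  fixes f :: "complex \<Rightarrow> complex"
  assumes "finite Z" "Z \<subseteq> S" "open S" and hol: "f holomorphic_on S"
    and "\<And>\<rho>. \<rho> \<in> Z \<Longrightarrow> \<exists>h. h analytic_on {\<rho>} \<and> eventually (\<lambda>s. f s = (s - \<rho>) ^ m \<rho> * h s) (nhds \<rho>)"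
  shows "\<exists>f1. f1 holomorphic_on S \<and> (\<forall>s\<in>S. f s = f1 s * (\<Prod>\<rho>\<in>Z. (s - \<rho>) ^ m \<rho>))"
  using assms(1,2,5)
proof (induction Z rule: finite_induct)
  case empty
  thus ?case using hol by auto
next
  case (insert \<rho> Z)
  then obtain f1 where f1: "f1 holomorphic_on S" "\<And>s. s \<in> S \<Longrightarrow> f s = f1 s * (\<Prod>\<rho>\<in>Z. (s - \<rho>) ^ m \<rho>)"
    by auto
  obtain h where h: "h analytic_on {\<rho>}" "eventually (\<lambda>s. f s = (s - \<rho>) ^ m \<rho> * h s) (nhds \<rho>)"
    using insert.prems by auto
  define P where "P = (\<lambda>s. \<Prod>\<rho>\<in>Z. (s - \<rho>) ^ m \<rho>)"
  \<comment> \<open>The value at \<open>\<rho>\<close> is chosen so that \<open>f2\<close> agrees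
    with \<open>h / P\<close> on a full neighbourhood, which makes it analytic there.\<close>
  define f2 where "f2 = (\<lambda>s. if s = \<rho> then h \<rho> / P \<rho> else f1 s / (s - \<rho>) ^ m \<rho>)"
  have P0: "P s \<noteq> 0" if "s \<notin> Z" for s
    using that insert.hyps by (auto simp: P_def)
  have eq: "f s = f2 s * ((s - \<rho>) ^ m \<rho> * P s)" if "s \<in> S" "s \<noteq> \<rho>" for s
    using f1(2)[OF that(1)] that(2) by (simp add: f2_def P_def)
  have ev: "eventually (\<lambda>s. s \<in> S \<and> s \<notin> Z) (nhds \<rho>)"
    using insert eventually_nhds_in_open[of "S - Z" \<rho>] \<open>open S\<close> by (auto intro: finite_imp_closed open_Diff)
  have ev2: "eventually (\<lambda>s. f2 s = h s / P s) (nhds \<rho>)"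
    using ev h(2)
  proof eventually_elim
    case (elim s)
    thus ?case using P0[of s] eq[of s] by (cases "s = \<rho>") (auto simp: f2_def field_simps)
  qed
  have "f2 analytic_on {s}" if "s \<in> S" for s
  proof (cases "s = \<rho>")
    case True
    have "(\<lambda>s. h s / P s) analytic_on {\<rho>}"
      using P0[of \<rho>] insert.hyps by (intro analytic_intros h) (auto simp: P_def intro!: analytic_intros)
    thus ?thesis using analytic_at_cong[OF ev2 refl] True by simp
  next
    case False
    have "(\<lambda>s. f1 s / (s - \<rho>) ^ m \<rho>) holomorphic_on (S - {\<rho>})"
      by (intro holomorphic_intros holomorphic_on_subset[OF f1(1)]) auto
    hence "f2 holomorphic_on (S - {\<rho>})"
      by (rule holomorphic_transform) (auto simp: f2_def)
    moreover have "open (S - {\<rho>})" using \<open>open S\<close> by auto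
    ultimately show ?thesis using False that analytic_at by auto
  qed
  hence f2: "f2 holomorphic_on S"
    using analytic_on_analytic_at analytic_imp_holomorphic by blast
  moreover have "f s = f2 s * ((s - \<rho>) ^ m \<rho> * P s)" if "s \<in> S" for s
  proof (cases "s = \<rho>")
    case True
    have "f \<rho> = (\<rho> - \<rho>) ^ m \<rho> * h \<rho>" using h(2) eventually_nhds_x_imp_x by blast
    thus ?thesis using P0[of \<rho>] insert.hyps True by (simp add: f2_def)
  qed (use eq that in auto)
  ultimately show ?case
    using insert.hyps by (auto simp: P_def)
qed

text \<open>Replacing each zero by its reflection preserves the modulus on the line. At the point
  \<open>s0 = Complex (\<alpha> + d) k\<close> it enlarges the squared modulus of each factor by at
  least \<open>exp x\<close>, where \<open>x\<close> is the summand in the exponent. The Poisson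
  formula for the square of the new function, with absolute values inside the integral, then gives
  the claim.\<close>

lemma jensen_half_plane:
  fixes f f1 :: "complex \<Rightarrow> complex" and m :: "complex \<Rightarrow> nat"
  assumes "c < \<alpha>" and "finite Z" and hol: "f1 holomorphic_on {s. Re s > c}"
    and f: "\<And>s. Re s > c \<Longrightarrow> f s = f1 s * (\<Prod>\<rho>\<in>Z. (s - \<rho>) ^ m \<rho>)"
    and bd: "\<And>s. Re s \<ge> \<alpha> \<Longrightarrow> norm (f s) \<le> M"
    and Z: "\<And>\<rho>. \<rho> \<in> Z \<Longrightarrow> Re \<rho> > \<alpha>" and "d > 0"
  shows "pi / d * (norm (f (Complex (\<alpha> + d) k)))\<^sup>2 *
      exp (\<Sum>\<rho>\<in>Z. m \<rho> * (4 * d * (Re \<rho> - \<alpha>) / ((d + (Re \<rho> - \<alpha>))\<^sup>2 + (k - Im \<rho>)\<^sup>2)))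
      \<le> (LINT t|lborel. (norm (f (Complex \<alpha> t)))\<^sup>2 / (d\<^sup>2 + (t - k)\<^sup>2))"
proof -
  \<comment> \<open>\<open>r \<rho>\<close> is the reflection of \<open>\<rho>\<close> in the line \<open>Re s = \<alpha>\<close>; passing from \<open>f\<close> to \<open>g\<close> divides by a
    finite Blaschke product of the half plane.\<close>
  define r where "r = (\<lambda>\<rho>. of_real (2 * \<alpha>) - cnj \<rho>)"
  define g where "g = (\<lambda>s. f1 s * (\<Prod>\<rho>\<in>Z. (s - r \<rho>) ^ m \<rho>))"
  define s0 where "s0 = Complex (\<alpha> + d) k"
  have M: "M \<ge> 0" using bd[of "Complex \<alpha> 0"] norm_ge_zero order_trans by (metis complex.sel(1) order_refl)
  have gh: "g holomorphic_on {s. Re s > c}"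
    unfolding g_def by (intro holomorphic_intros hol)
  have g_line: "norm (g (Complex \<alpha> t)) = norm (f (Complex \<alpha> t))" for t
  proof -
    have "norm (Complex \<alpha> t - r \<rho>) = norm (Complex \<alpha> t - \<rho>)" for \<rho>
    proof -
      have "Complex \<alpha> t - r \<rho> = - cnj (Complex \<alpha> t - \<rho>)" by (simp add: r_def complex_eq_iff)
      thus ?thesis by (simp only: norm_minus_cancel complex_mod_cnj)
    qed
    thus ?thesis using f[of "Complex \<alpha> t"] \<open>c < \<alpha>\<close>
      by (simp add: g_def norm_mult norm_power flip: prod_norm)
  qed
  \<comment> \<open>The Poisson formula needs some bound on \<open>g\<close>; its size does not
    enter the result. Away from unit discs around the zeros, \<open>|s - r \<rho>|\<close> is at
    most a constant times \<open>|s - \<rho>|\<close>, so the bound for \<open>f\<close> carries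
    over. The discs, cut off at the line, form a compact set.\<close>
  obtain M2 where M2: "\<And>s. Re s \<ge> \<alpha> \<Longrightarrow> norm (g s) \<le> M2"
  proof -
    define U where "U = (\<Union>\<rho>\<in>Z. cball \<rho> 1) \<inter> {s. Re s \<ge> \<alpha>}"
    define K where "K = (\<Prod>\<rho>\<in>Z. (1 + norm (\<rho> - r \<rho>)) ^ m \<rho>)"
    have "K \<ge> 0" unfolding K_def by (intro prod_nonneg) auto
    have "compact U" unfolding U_def
      using \<open>finite Z\<close> by (intro compact_Int_closed closed_halfspace_Re_ge compact_UN) auto
    moreover have "continuous_on U g"
      using holomorphic_on_imp_continuous_on[OF gh] by (rule continuous_on_subset) (use \<open>c < \<alpha>\<close> in \<open>auto simp: U_def\<close>)
    ultimately have "compact (g ` U)" by (rule compact_continuous_image[rotated])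
    then obtain M1 where M1: "\<And>s. s \<in> U \<Longrightarrow> norm (g s) \<le> M1"
      using compact_imp_bounded bounded_iff by (metis imageI)
    have "norm (g s) \<le> max (M * K) M1" if "Re s \<ge> \<alpha>" for s
    proof (cases "s \<in> U")
      case True
      thus ?thesis using M1 by (simp add: max.coboundedI2)
    next
      case False
      have "norm (s - r \<rho>) \<le> norm (s - \<rho>) * (1 + norm (\<rho> - r \<rho>))" if "\<rho> \<in> Z" for \<rho>
      proof -
        have "norm (s - \<rho>) \<ge> 1" using False that \<open>Re s \<ge> \<alpha>\<close> by (auto simp: U_def dist_norm norm_minus_commute)
        hence "norm (\<rho> - r \<rho>) \<le> norm (s - \<rho>) * norm (\<rho> - r \<rho>)"
          using mult_right_mono[of 1 "norm (s - \<rho>)" "norm (\<rho> - r \<rho>)"] by simp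
        moreover have "norm (s - r \<rho>) \<le> norm (s - \<rho>) + norm (\<rho> - r \<rho>)"
          using norm_triangle_ineq[of "s - \<rho>" "\<rho> - r \<rho>"] by simp
        ultimately show ?thesis by (simp add: algebra_simps)
      qed
      hence "(\<Prod>\<rho>\<in>Z. norm (s - r \<rho>) ^ m \<rho>) \<le> (\<Prod>\<rho>\<in>Z. (norm (s - \<rho>) * (1 + norm (\<rho> - r \<rho>))) ^ m \<rho>)"
        by (intro prod_mono conjI power_mono) auto
      also have "\<dots> = (\<Prod>\<rho>\<in>Z. norm (s - \<rho>) ^ m \<rho>) * K"
        by (simp add: K_def power_mult_distrib prod.distrib)
      finally have "norm (g s) \<le> norm (f1 s) * ((\<Prod>\<rho>\<in>Z. norm (s - \<rho>) ^ m \<rho>) * K)"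
        unfolding g_def by (auto simp: norm_mult norm_power simp flip: prod_norm intro!: mult_left_mono)
      also have "\<dots> = norm (f s) * K"
        using f[of s] \<open>c < \<alpha>\<close> that by (simp add: norm_mult norm_power flip: prod_norm)
      also have "\<dots> \<le> M * K" using bd[OF that] \<open>K \<ge> 0\<close> by (rule mult_right_mono)
      finally show ?thesis by simp
    qed
    thus ?thesis using that by blast
  qed
  have hol2: "(\<lambda>s. (g s)\<^sup>2) holomorphic_on {s. Re s > c}" by (intro holomorphic_intros gh)
  have bd2: "norm ((g s)\<^sup>2) \<le> M2\<^sup>2" if "Re s \<ge> \<alpha>" for s
    using M2[OF that] by (simp add: norm_power power_mono)
  note P = poisson_half_plane[OF \<open>c < \<alpha>\<close> hol2 bd2 \<open>d > 0\<close>, of k]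
  have P2: "of_real (pi / d) * (g s0)\<^sup>2 = (LINT t|lborel. (g (Complex \<alpha> t))\<^sup>2 / of_real (d\<^sup>2 + (t - k)\<^sup>2))"
    unfolding s0_def by (rule P[symmetric])
  have "norm (of_real (pi / d) * (g s0)\<^sup>2) \<le> (LINT t|lborel. norm ((g (Complex \<alpha> t))\<^sup>2 / of_real (d\<^sup>2 + (t - k)\<^sup>2)))"
    unfolding P2 by (rule Bochner_Integration.integral_norm_bound)
  also have "\<dots> = (LINT t|lborel. (norm (f (Complex \<alpha> t)))\<^sup>2 / (d\<^sup>2 + (t - k)\<^sup>2))"
    by (intro Bochner_Integration.integral_cong)
       (auto simp: norm_divide norm_power g_line simp del: of_real_add of_real_power)
  also have "norm (of_real (pi / d) * (g s0)\<^sup>2) = pi / d * (norm (g s0))\<^sup>2"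
    using \<open>d > 0\<close> by (simp add: norm_mult norm_power norm_divide)
  finally have main: "pi / d * (norm (g s0))\<^sup>2 \<le> (LINT t|lborel. (norm (f (Complex \<alpha> t)))\<^sup>2 / (d\<^sup>2 + (t - k)\<^sup>2))" .
  define x where "x = (\<lambda>\<rho>. 4 * d * (Re \<rho> - \<alpha>) / ((d + (Re \<rho> - \<alpha>))\<^sup>2 + (k - Im \<rho>)\<^sup>2))"
  \<comment> \<open>The squared distances from \<open>s0\<close> to \<open>r \<rho>\<close> and to
    \<open>\<rho>\<close> are \<open>(d + \<delta>)^2 + (k - Im \<rho>)^2\<close> and
    \<open>(d - \<delta>)^2 + (k - Im \<rho>)^2\<close> with
    \<open>\<delta> = Re \<rho> - \<alpha>\<close>. They differ by \<open>4 * d * \<delta>\<close>,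
    so their ratio is \<open>1 - x \<rho>\<close>.\<close>
  have fac: "(norm (s0 - \<rho>))\<^sup>2 \<le> (norm (s0 - r \<rho>))\<^sup>2 * exp (- x \<rho>)" if "\<rho> \<in> Z" for \<rho>
  proof -
    define A where "A = (d + (Re \<rho> - \<alpha>))\<^sup>2 + (k - Im \<rho>)\<^sup>2"
    have "d + (Re \<rho> - \<alpha>) > 0" using Z[OF that] \<open>d > 0\<close> by simp
    hence A: "A > 0" unfolding A_def by (simp add: add_pos_nonneg)
    have "(norm (s0 - r \<rho>))\<^sup>2 = A"
      by (simp add: A_def cmod_power2 s0_def r_def algebra_simps)
    moreover have "(norm (s0 - \<rho>))\<^sup>2 = A * (1 - x \<rho>)"
    proof -
      have "x \<rho> = 4 * d * (Re \<rho> - \<alpha>) / A" by (simp only: x_def A_def)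
      hence "A * x \<rho> = 4 * d * (Re \<rho> - \<alpha>)" using A by simp
      hence "A * (1 - x \<rho>) = A - 4 * d * (Re \<rho> - \<alpha>)" by (simp only: right_diff_distrib mult_1_right)
      also have "\<dots> = (d - (Re \<rho> - \<alpha>))\<^sup>2 + (k - Im \<rho>)\<^sup>2"
        by (simp add: A_def power2_eq_square algebra_simps)
      also have "\<dots> = (norm (s0 - \<rho>))\<^sup>2" by (simp add: cmod_power2 s0_def algebra_simps)
      finally show ?thesis by simp
    qed
    moreover have "1 - x \<rho> \<le> exp (- x \<rho>)" using exp_ge_add_one_self[of "- x \<rho>"] by simp
    ultimately show ?thesis using A by simp
  qed
  have "(norm (f s0))\<^sup>2 = (norm (f1 s0))\<^sup>2 * (\<Prod>\<rho>\<in>Z. ((norm (s0 - \<rho>))\<^sup>2) ^ m \<rho>)"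
    using f[of s0] \<open>c < \<alpha>\<close> \<open>d > 0\<close>
    by (simp add: s0_def norm_mult norm_power power_mult_distrib prod_power_distrib flip: prod_norm power_mult)
       (simp add: mult.commute)
  also have "\<dots> \<le> (norm (f1 s0))\<^sup>2 * (\<Prod>\<rho>\<in>Z. ((norm (s0 - r \<rho>))\<^sup>2 * exp (- x \<rho>)) ^ m \<rho>)"
    by (intro mult_left_mono prod_mono conjI power_mono fac) auto
  also have "\<dots> = (norm (g s0))\<^sup>2 * exp (- (\<Sum>\<rho>\<in>Z. m \<rho> * x \<rho>))"
  proof -
    have "(\<Prod>\<rho>\<in>Z. exp (- x \<rho>) ^ m \<rho>) = exp (- (\<Sum>\<rho>\<in>Z. m \<rho> * x \<rho>))"
      using \<open>finite Z\<close> by (simp add: exp_sum flip: exp_of_nat_mult sum_negf)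
    moreover have "(norm (g s0))\<^sup>2 = (norm (f1 s0))\<^sup>2 * (\<Prod>\<rho>\<in>Z. ((norm (s0 - r \<rho>))\<^sup>2) ^ m \<rho>)"
      by (simp add: g_def norm_mult norm_power power_mult_distrib prod_power_distrib flip: prod_norm power_mult)
         (simp add: mult.commute)
    ultimately show ?thesis by (simp add: power_mult_distrib prod.distrib)
  qed
  finally have "(norm (f s0))\<^sup>2 * exp (\<Sum>\<rho>\<in>Z. m \<rho> * x \<rho>) \<le> (norm (g s0))\<^sup>2"
    by (simp add: exp_minus field_simps)
  hence "pi / d * ((norm (f s0))\<^sup>2 * exp (\<Sum>\<rho>\<in>Z. m \<rho> * x \<rho>)) \<le> pi / d * (norm (g s0))\<^sup>2"
    using \<open>d > 0\<close> by (intro mult_left_mono) auto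
  also note main
  finally show ?thesis by (simp add: s0_def x_def mult.assoc)
qed

subsection \<open>Dirichlet series with bounded partial sums\<close>

text \<open>The mean value inequality for \<open>z powr (- s)\<close> on the segment from
  \<open>n\<close> to \<open>n + 1\<close>, where the derivative is largest in modulus at
  \<open>n\<close>.\<close>

lemma norm_powr_diff_le:
  assumes "n \<ge> 1" "Re s > 0"
  shows "norm (of_nat n powr (- s) - of_nat (Suc n) powr (- s)) \<le> norm s * real n powr (-1 - Re s)"
proof -
  define S where "S = complex_of_real ` {real n..real (Suc n)}"
  have "convex S" unfolding S_def
    by (intro convex_linear_image bounded_linear.linear bounded_linear_of_real) auto
  have "norm (of_nat n powr (- s) - of_nat (Suc n) powr (- s))
      \<le> norm s * real n powr (-1 - Re s) * norm (complex_of_nat n - of_nat (Suc n))"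
  proof (rule field_differentiable_bound[OF \<open>convex S\<close>])
    fix z assume "z \<in> S"
    then obtain x where x: "z = of_real x" "real n \<le> x" by (auto simp: S_def)
    have "x > 0" using x assms by linarith
    show "((\<lambda>z. z powr (- s)) has_field_derivative (- s * z powr (- s - 1))) (at z within S)"
      using \<open>x > 0\<close> x by (auto intro!: derivative_eq_intros simp: complex_nonpos_Reals_iff)
    have "norm (z powr (- s - 1)) = x powr Re (- s - 1)"
      using \<open>x > 0\<close> x by (simp add: norm_powr_real_powr)
    also have "Re (- s - 1) = -1 - Re s" by simp
    also have "x powr (-1 - Re s) \<le> real n powr (-1 - Re s)"
      using x assms by (intro powr_mono2') auto
    finally show "norm (- s * z powr (- s - 1)) \<le> norm s * real n powr (-1 - Re s)"
      by (simp add: norm_mult mult_left_mono)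
  next
    show "complex_of_nat n \<in> S" unfolding S_def by (rule image_eqI[of _ _ "real n"]) auto
    show "complex_of_nat (Suc n) \<in> S" unfolding S_def by (rule image_eqI[of _ _ "real (Suc n)"]) auto
  qed
  thus ?thesis by simp
qed

text \<open>Abel summation rewrites the series through the bounded partial sums \<open>B n\<close>
  and the differences of consecutive powers. The new terms are
  \<open>O (|s| * n powr (-1 - Re s))\<close>, so the sum converges absolutely and locally uniformly
  for \<open>Re s > 0\<close>, which gives both holomorphy and the growth bound.\<close>

lemma dirichlet_series_bounded_partial_sums:
  fixes b :: "nat \<Rightarrow> complex"
  assumes bd: "\<And>N. norm (\<Sum>n=1..N. b n) \<le> M"
  obtains G where "G holomorphic_on {s. Re s > 0}"
    and "\<And>s. Re s > 0 \<Longrightarrow> (\<lambda>N. \<Sum>n=1..N. b n * of_nat n powr (- s)) \<longlonglongrightarrow> G s"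
    and "\<And>s. Re s > 0 \<Longrightarrow> norm (G s) \<le> M * norm s * (1 + 1 / Re s)"
proof -
  define B where "B = (\<lambda>N. \<Sum>n=1..N. b n)"
  have M: "M \<ge> 0" using bd[of 0] by simp
  define h where "h = (\<lambda>n s. B n * (of_nat n powr (- s) - of_nat (Suc n) powr (- s)))"
  define G where "G = (\<lambda>s. \<Sum>n. h (Suc n) s)"
  have h_le: "norm (h n s) \<le> M * norm s * real n powr (-1 - Re s)" if "n \<ge> 1" "Re s > 0" for n s
    unfolding h_def norm_mult mult.assoc
    by (intro mult_mono norm_powr_diff_le that M) (use bd in \<open>auto simp: B_def\<close>)
  have sm: "summable (\<lambda>n. real (Suc n) powr (-1 - u))" if "u > 0" for u
    by (subst summable_Suc_iff, subst summable_real_powr_iff) (use that in auto)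
  have unif: "\<exists>d>0. cball s d \<subseteq> {s. Re s > 0} \<and> uniform_limit (cball s d) (\<lambda>N s. \<Sum>n<N. h (Suc n) s) G sequentially"
    if s: "Re s > 0" for s
  proof (intro exI conjI)
    \<comment> \<open>On this disc real parts stay at least \<open>Re s / 2\<close>, so one
      convergent majorant serves all its points.\<close>
    define d where "d = Re s / 2"
    have d: "Re z \<ge> d \<and> norm z \<le> norm s + d" if "z \<in> cball s d" for z
    proof -
      have "\<bar>Re (s - z)\<bar> \<le> d" using that abs_Re_le_cmod[of "s - z"] by (simp add: dist_norm)
      moreover have "norm (z - s) \<le> d" using that by (simp add: dist_norm norm_minus_commute)
      hence "norm z \<le> norm s + d" using norm_triangle_sub[of z s] by linarith
      ultimately show ?thesis unfolding d_def minus_complex.sel by linarith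
    qed
    show "d > 0" using s by (simp add: d_def)
    show "cball s d \<subseteq> {s. Re s > 0}" using d \<open>d > 0\<close> by force
    show "uniform_limit (cball s d) (\<lambda>N s. \<Sum>n<N. h (Suc n) s) G sequentially"
      unfolding G_def
    proof (rule Weierstrass_m_test)
      show "summable (\<lambda>n. M * (norm s + d) * real (Suc n) powr (-1 - d))"
        using \<open>d > 0\<close> by (intro summable_mult sm)
      fix n z assume z: "z \<in> cball s d"
      have "norm (h (Suc n) z) \<le> M * norm z * real (Suc n) powr (-1 - Re z)"
        using d[OF z] \<open>d > 0\<close> by (intro h_le) auto
      also have "\<dots> \<le> M * (norm s + d) * real (Suc n) powr (-1 - d)"
        using d[OF z] M \<open>d > 0\<close> by (intro mult_mono mult_left_mono powr_mono) auto
      finally show "norm (h (Suc n) z) \<le> M * (norm s + d) * real (Suc n) powr (-1 - d)" .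
    qed
  qed
  have "G holomorphic_on {s. Re s > 0}"
  proof (rule holomorphic_uniform_sequence[OF open_halfspace_Re_gt])
    show "(\<lambda>s. \<Sum>n<N. h (Suc n) s) holomorphic_on {s. Re s > 0}" for N
      unfolding h_def by (intro holomorphic_intros) (simp_all del: of_nat_Suc)
  qed (use unif in simp)
  moreover have lim: "(\<lambda>N. \<Sum>n=1..N. h n s) \<longlonglongrightarrow> G s" if s: "Re s > 0" for s
  proof -
    have "summable (\<lambda>n. h (Suc n) s)"
    proof (rule summable_comparison_test')
      show "summable (\<lambda>n. M * norm s * real (Suc n) powr (-1 - Re s))"
        by (intro summable_mult sm s)
      show "norm (h (Suc n) s) \<le> M * norm s * real (Suc n) powr (-1 - Re s)" if "n \<ge> 0" for n
        by (rule h_le) (use s in auto)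
    qed
    hence "(\<lambda>N. \<Sum>n<N. h (Suc n) s) \<longlonglongrightarrow> G s"
      unfolding G_def by (rule summable_LIMSEQ)
    moreover have "(\<Sum>n<N. h (Suc n) s) = (\<Sum>n=1..N. h n s)" for N
      by (simp add: sum.atLeast1_atMost_eq)
    ultimately show ?thesis by simp
  qed
  moreover have "(\<lambda>N. \<Sum>n=1..N. b n * of_nat n powr (- s)) \<longlonglongrightarrow> G s" if s: "Re s > 0" for s
  proof -
    \<comment> \<open>The boundary term of the Abel summation tends to \<open>0\<close>, since
      \<open>B\<close> is bounded and \<open>Re s > 0\<close>.\<close>
    have abel: "(\<Sum>n=1..N. b n * of_nat n powr (- s)) = (\<Sum>n=1..N. h n s) + B N * of_nat (Suc N) powr (- s)" for N
      by (induction N) (simp_all add: B_def h_def algebra_simps)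
    have "(\<lambda>N. B N * of_nat (Suc N) powr (- s)) \<longlonglongrightarrow> 0"
    proof (rule Lim_null_comparison)
      show "eventually (\<lambda>N. norm (B N * of_nat (Suc N) powr (- s)) \<le> M * real (Suc N) powr (- Re s)) sequentially"
      proof (rule always_eventually, rule allI)
        fix N
        have "norm (complex_of_nat (Suc N) powr (- s)) = real (Suc N) powr (- Re s)"
          using norm_powr_real_powr[of "of_nat (Suc N)" "- s"] by (simp del: of_nat_Suc)
        thus "norm (B N * of_nat (Suc N) powr (- s)) \<le> M * real (Suc N) powr (- Re s)"
          using bd[of N] by (simp add: norm_mult B_def mult_right_mono del: of_nat_Suc)
      qed
      show "(\<lambda>N. M * real (Suc N) powr (- Re s)) \<longlonglongrightarrow> 0"
        using s by real_asymp
    qed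
    from tendsto_add[OF lim[OF s] this] show ?thesis unfolding abel by simp
  qed
  moreover have "norm (G s) \<le> M * norm s * (1 + 1 / Re s)" if s: "Re s > 0" for s
  proof (rule LIMSEQ_le_const2[OF tendsto_norm[OF lim[OF s]]], intro exI allI impI)
    fix N :: nat
    have "norm (\<Sum>n=1..N. h n s) \<le> (\<Sum>n=1..N. M * norm s * real n powr (-1 - Re s))"
      by (intro sum_norm_le h_le s) auto
    also have "\<dots> \<le> M * norm s * (1 + 1 / Re s)"
      unfolding sum_distrib_left[symmetric] using M by (intro mult_left_mono sum_powr_le s) auto
    finally show "norm (\<Sum>n=1..N. h n s) \<le> M * norm s * (1 + 1 / Re s)" .
  qed
  ultimately show ?thesis using that by blast
qed

text \<open>Far to the right the first non-zero term dominates: with \<open>x = Re s\<close>, the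
  tail is at most \<open>2 * L * (n0 + 1) powr (2 - x)\<close>, smaller than
  \<open>n0 powr (-x)\<close> by a factor that decays geometrically in \<open>x\<close>.\<close>

lemma dirichlet_series_lower_bound:
  fixes b :: "nat \<Rightarrow> complex"
  assumes bd: "\<And>n. n \<ge> 1 \<Longrightarrow> norm (b n) \<le> L" and nz: "n0 \<ge> 1" "b n0 \<noteq> 0" "\<And>n. 1 \<le> n \<Longrightarrow> n < n0 \<Longrightarrow> b n = 0"
    and lim: "\<And>s. Re s > 0 \<Longrightarrow> (\<lambda>N. \<Sum>n=1..N. b n * of_nat n powr (- s)) \<longlonglongrightarrow> G s"
  obtains \<sigma> where "\<sigma> \<ge> 2" "\<And>s. Re s \<ge> \<sigma> \<Longrightarrow> norm (G s) \<ge> norm (b n0) * real n0 powr (- Re s) / 2"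
proof -
  have L: "L > 0" using bd[OF nz(1)] nz(2) by (metis norm_le_zero_iff not_le order_trans)
  define r where "r = real n0 / real (Suc n0)"
  have r: "r > 0" "r < 1" using nz by (auto simp: r_def)
  \<comment> \<open>With this \<open>e\<close>, the condition \<open>r powr x < e\<close> says that
    the tail bound is less than half the leading term.\<close>
  define e where "e = norm (b n0) / (4 * L * real (Suc n0) powr 2)"
  have e: "e > 0" using L nz by (simp add: e_def)
  obtain K where K: "r ^ K < e" using real_arch_pow_inv[OF e r(2)] by blast
  define \<sigma> where "\<sigma> = max 2 (real K)"
  show ?thesis
  proof (rule that[of \<sigma>])
    show "\<sigma> \<ge> 2" by (simp add: \<sigma>_def)
    fix s assume s: "Re s \<ge> \<sigma>"
    define x where "x = Re s"
    have x: "x \<ge> 2" "x \<ge> real K" using s by (auto simp: \<sigma>_def x_def)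
    have nrm: "norm (complex_of_nat n powr (- s)) = real n powr (- x)" for n
      using norm_powr_real_powr[of "of_nat n" "- s"] by (simp add: x_def)
    have "r powr x \<le> r powr real K" using x r by (intro powr_mono') auto
    also have "\<dots> < e" using K r by (simp add: powr_realpow)
    finally have "real n0 powr x / real (Suc n0) powr x < e"
      using nz by (simp add: r_def powr_divide)
    hence small: "2 * L * real (Suc n0) powr (2 - x) \<le> norm (b n0) * real n0 powr (- x) / 2"
      using L nz by (simp add: e_def powr_diff powr_minus field_simps del: of_nat_Suc)
    have "norm (G s - b n0 * of_nat n0 powr (- s)) \<le> 2 * L * real (Suc n0) powr (2 - x)"
    proof (rule LIMSEQ_le_const2[OF tendsto_norm[OF tendsto_diff[OF lim tendsto_const]]])
      show "Re s > 0" using x by (simp add: x_def)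
      show "\<exists>N. \<forall>n\<ge>N. norm ((\<Sum>n=1..n. b n * of_nat n powr (- s)) - b n0 * of_nat n0 powr (- s)) \<le> 2 * L * real (Suc n0) powr (2 - x)"
      proof (intro exI allI impI)
        fix N assume N: "N \<ge> n0"
        have "(\<Sum>n=1..N. b n * of_nat n powr (- s)) - b n0 * of_nat n0 powr (- s) = (\<Sum>n\<in>{1..N} - {n0}. b n * of_nat n powr (- s))"
          using N nz by (subst sum.remove[of _ n0]) auto
        also have "norm \<dots> \<le> (\<Sum>n\<in>{1..N} - {n0}. L * real (Suc n0) powr (2 - x) * real n powr (-1 - 1))"
        proof (rule sum_norm_le)
          fix n assume n: "n \<in> {1..N} - {n0}"
          show "norm (b n * of_nat n powr (- s)) \<le> L * real (Suc n0) powr (2 - x) * real n powr (-1 - 1)"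
          proof (cases "n < n0")
            case True
            thus ?thesis using nz(3)[of n] n L by auto
          next
            case False
            hence "n \<ge> Suc n0" using n by auto
            have "norm (b n * of_nat n powr (- s)) \<le> L * real n powr (- x)"
              unfolding norm_mult nrm using bd[of n] n by (intro mult_right_mono) auto
            \<comment> \<open>Two powers are kept for convergence. The other factor has exponent
              \<open>2 - x \<le> 0\<close>, hence is largest at \<open>n0 + 1\<close>; this is why
              \<open>\<sigma> \<ge> 2\<close>.\<close>
            also have "real n powr (- x) = real n powr (2 - x) * real n powr (-1 - 1)"
              using n by (simp flip: powr_add)
            also have "real n powr (2 - x) \<le> real (Suc n0) powr (2 - x)"
              using \<open>n \<ge> Suc n0\<close> x by (intro powr_mono2') auto
            finally show ?thesis using L by (simp add: mult_left_mono mult_right_mono mult.assoc)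
          qed
        qed
        also have "\<dots> \<le> (\<Sum>n=1..N. L * real (Suc n0) powr (2 - x) * real n powr (-1 - 1))"
          using L by (intro sum_mono2) auto
        also have "\<dots> \<le> L * real (Suc n0) powr (2 - x) * (1 + 1 / 1)"
          unfolding sum_distrib_left[symmetric] using L by (intro mult_left_mono sum_powr_le) auto
        finally show "norm ((\<Sum>n=1..N. b n * of_nat n powr (- s)) - b n0 * of_nat n0 powr (- s)) \<le> 2 * L * real (Suc n0) powr (2 - x)"
          by simp
      qed
    qed
    moreover have "norm (b n0 * of_nat n0 powr (- s)) = norm (b n0) * real n0 powr (- x)"
      by (simp add: norm_mult nrm)
    moreover have "norm (b n0 * of_nat n0 powr (- s)) \<le> norm (G s) + norm (G s - b n0 * of_nat n0 powr (- s))"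
      by (metis norm_triangle_sub norm_minus_commute)
    ultimately show "norm (G s) \<ge> norm (b n0) * real n0 powr (- Re s) / 2"
      using small by (simp add: x_def)
  qed
qed

subsection \<open>Counting zeros\<close>

text \<open>On symmetric intervals the bound \<open>5 - 4 / (N + 1)\<close> is exact at
  \<open>N = 0\<close>, and its increments dominate the two new terms at each step.\<close>

lemma sum_inverse_one_plus_square_le:
  fixes A :: "int set"
  assumes "finite A"
  shows "(\<Sum>k\<in>A. 1 / (1 + (real_of_int k)\<^sup>2)) \<le> 5"
proof -
  have *: "(\<Sum>k\<in>{- int N..int N}. 1 / (1 + (real_of_int k)\<^sup>2)) \<le> 5 - 4 / (real N + 1)" for N
  proof (induction N)
    case 0
    show ?case by simp
  next
    case (Suc N)
    have "{- int (Suc N)..int (Suc N)} = insert (int (Suc N)) (insert (- int (Suc N)) {- int N..int N})"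
      by auto
    hence "(\<Sum>k\<in>{- int (Suc N)..int (Suc N)}. 1 / (1 + (real_of_int k)\<^sup>2)) =
      2 / (1 + (real N + 1)\<^sup>2) + (\<Sum>k\<in>{- int N..int N}. 1 / (1 + (real_of_int k)\<^sup>2))"
      using power2_minus[of "1 + real N"] by (simp add: algebra_simps)
    moreover have "2 / (1 + (x + 1)\<^sup>2) \<le> 4 / (x + 1) - 4 / (x + 2)" if "x \<ge> 0" for x :: real
    proof -
      have "2 / (1 + (x + 1)\<^sup>2) \<le> 4 / ((x + 1) * (x + 2))"
      proof (subst frac_le_eq)
        show "1 + (x + 1)\<^sup>2 \<noteq> 0" using that by (smt (verit) zero_le_power2)
        show "(x + 1) * (x + 2) \<noteq> 0" using that by simp
        have "2 * ((x + 1) * (x + 2)) - 4 * (1 + (x + 1)\<^sup>2) = - (2 * (x * x) + 2 * x + 4)"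
          by (simp add: power2_eq_square algebra_simps)
        also have "\<dots> \<le> 0" using that mult_nonneg_nonneg[OF that that] by linarith
        finally have "2 * ((x + 1) * (x + 2)) - 4 * (1 + (x + 1)\<^sup>2) \<le> 0" .
        moreover have "(1 + (x + 1)\<^sup>2) * ((x + 1) * (x + 2)) \<ge> 0" using that by simp
        ultimately show "(2 * ((x + 1) * (x + 2)) - 4 * (1 + (x + 1)\<^sup>2)) / ((1 + (x + 1)\<^sup>2) * ((x + 1) * (x + 2))) \<le> 0"
          by (rule divide_nonpos_nonneg)
      qed
      also have "\<dots> = 4 / (x + 1) - 4 / (x + 2)" using that by (simp add: field_simps)
      finally show ?thesis .
    qed
    from this[of "real N"] have "2 / (1 + (real N + 1)\<^sup>2) \<le> 4 / (real N + 1) - 4 / (real (Suc N) + 1)"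
      by (simp add: add.commute)
    ultimately show ?case using Suc by linarith
  qed
  define N where "N = nat (Max (insert 0 (abs ` A)))"
  have "A \<subseteq> {- int N..int N}"
  proof
    fix k assume "k \<in> A"
    hence "\<bar>k\<bar> \<le> Max (insert 0 (abs ` A))" using assms by (intro Max_ge) auto
    thus "k \<in> {- int N..int N}" by (auto simp: N_def)
  qed
  hence "(\<Sum>k\<in>A. 1 / (1 + (real_of_int k)\<^sup>2)) \<le> (\<Sum>k\<in>{- int N..int N}. 1 / (1 + (real_of_int k)\<^sup>2))"
    by (intro sum_mono2) auto
  also have "\<dots> \<le> 5" using *[of N] by (smt (verit) divide_nonneg_nonneg of_nat_0_le_iff)
  finally show ?thesis .
qed

text \<open>This lets local mean squares around the integers \<open>k\<close> be summed into one
  global mean square at scale \<open>K\<close>. For \<open>|t| \<le> 2 * K\<close> the left side is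
  at most \<open>15\<close>, while the quotient on the right without its factor \<open>75\<close> is
  at least \<open>1 / 5\<close>. For larger \<open>|t|\<close> every weight is at most
  \<open>4 / t^2\<close>.\<close>

lemma sum_cauchy_weights_le:
  fixes t :: real and K :: nat
  assumes "K \<ge> 1"
  shows "(\<Sum>k\<in>{- int K..int K}. 1 / (1 + (t - of_int k)\<^sup>2)) \<le> 75 * (real K)\<^sup>2 / ((real K)\<^sup>2 + t\<^sup>2)"
proof (cases "\<bar>t\<bar> \<le> 2 * real K")
  case True
  define j where "j = \<lfloor>t\<rfloor>"
  have "(\<Sum>k\<in>{- int K..int K}. 1 / (1 + (t - of_int k)\<^sup>2)) \<le> (\<Sum>k\<in>{- int K..int K}. 3 * (1 / (1 + (of_int (k - j))\<^sup>2)))"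
  proof (rule sum_mono)
    fix k
    define x y where "x = t - of_int k" and "y = t - of_int j"
    have "\<bar>y\<bar> \<le> 1" by (auto simp: y_def j_def) linarith
    hence "y\<^sup>2 \<le> 1" by (simp add: abs_square_le_1)
    have "(of_int (k - j))\<^sup>2 = (y - x)\<^sup>2" by (simp add: x_def y_def)
    also have "\<dots> \<le> 2 * x\<^sup>2 + 2 * y\<^sup>2"
      using zero_le_power2[of "x + y"] by (simp add: power2_eq_square algebra_simps)
    finally have "1 + (of_int (k - j))\<^sup>2 \<le> 3 * (1 + x\<^sup>2)" using \<open>y\<^sup>2 \<le> 1\<close> by (smt (verit) zero_le_power2)
    moreover have "1 + x\<^sup>2 > 0" "1 + (real_of_int (k - j))\<^sup>2 > 0" by (auto intro: add_pos_nonneg)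
    ultimately have "1 / (1 + x\<^sup>2) \<le> 3 * (1 / (1 + (of_int (k - j))\<^sup>2))"
      by (simp add: divide_simps)
    thus "1 / (1 + (t - of_int k)\<^sup>2) \<le> 3 * (1 / (1 + (of_int (k - j))\<^sup>2))" by (simp add: x_def)
  qed
  also have "\<dots> = 3 * (\<Sum>k\<in>(\<lambda>k. k - j) ` {- int K..int K}. 1 / (1 + (of_int k)\<^sup>2))"
    by (subst sum.reindex) (auto simp: inj_on_def sum_distrib_left)
  also have "\<dots> \<le> 15" using sum_inverse_one_plus_square_le[of "(\<lambda>k. k - j) ` {- int K..int K}"] by simp
  also have "\<dots> \<le> 75 * (real K)\<^sup>2 / ((real K)\<^sup>2 + t\<^sup>2)"
  proof -
    have "t\<^sup>2 \<le> (2 * real K)\<^sup>2" using True by (rule power2_le_iff_abs_le[THEN iffD2, rotated]) simp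
    hence "15 * ((real K)\<^sup>2 + t\<^sup>2) \<le> 75 * (real K)\<^sup>2" by simp
    moreover have "(real K)\<^sup>2 + t\<^sup>2 > 0" using assms by (intro add_pos_nonneg) auto
    ultimately show ?thesis by (simp add: pos_le_divide_eq)
  qed
  finally show ?thesis .
next
  case False
  have K: "real K \<ge> 1" using assms by simp
  have t0: "t\<^sup>2 > 0" using False K by auto
  have "(\<Sum>k\<in>{- int K..int K}. 1 / (1 + (t - of_int k)\<^sup>2)) \<le> (\<Sum>k\<in>{- int K..int K}. 4 / t\<^sup>2)"
  proof (rule sum_mono)
    fix k assume "k \<in> {- int K..int K}"
    hence "\<bar>real_of_int k\<bar> \<le> real K" by auto
    hence "\<bar>t / 2\<bar> \<le> \<bar>t - of_int k\<bar>" using False by linarith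
    hence "(t / 2)\<^sup>2 \<le> (t - of_int k)\<^sup>2" by (simp only: abs_le_square_iff)
    hence "t\<^sup>2 \<le> 4 * (1 + (t - of_int k)\<^sup>2)" by (simp add: power_divide)
    thus "1 / (1 + (t - of_int k)\<^sup>2) \<le> 4 / t\<^sup>2"
      using t0 by (simp add: divide_simps add_pos_nonneg mult.commute)
  qed
  also have "\<dots> = (2 * real K + 1) * (4 / t\<^sup>2)" by simp
  also have "\<dots> \<le> (3 * (real K)\<^sup>2) * (4 / t\<^sup>2)"
  proof (rule mult_right_mono)
    have "real K \<le> (real K)\<^sup>2"
      using mult_left_mono[OF K, of "real K"] by (simp add: power2_eq_square)
    thus "2 * real K + 1 \<le> 3 * (real K)\<^sup>2" using K by linarith
  qed (use t0 in simp)
  also have "\<dots> \<le> 75 * (real K)\<^sup>2 / ((real K)\<^sup>2 + t\<^sup>2)"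
  proof -
    have "(real K)\<^sup>2 \<le> t\<^sup>2" using False K by (intro abs_le_square_iff[THEN iffD1]) linarith
    moreover have "12 * (x + y) \<le> 75 * y" if "x \<le> y" "0 < y" for x y :: real
      using that by simp
    ultimately have "12 * ((real K)\<^sup>2 + t\<^sup>2) \<le> 75 * t\<^sup>2" using t0 by blast
    hence "(real K)\<^sup>2 * (12 * ((real K)\<^sup>2 + t\<^sup>2)) \<le> (real K)\<^sup>2 * (75 * t\<^sup>2)" by (rule mult_left_mono) simp
    moreover have "(real K)\<^sup>2 + t\<^sup>2 > 0" using t0 by (intro add_nonneg_pos) auto
    ultimately show ?thesis using t0 by (simp add: divide_simps algebra_simps)
  qed
  finally show ?thesis .
qed

text \<open>The set \<open>Z\<close> is an arbitrary finite set of zeros and \<open>m\<close> any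
  exponents that divide out locally, so finiteness of the full zero set can be deduced from the
  bound afterwards. The constant depends only on \<open>M\<close>, \<open>\<sigma>\<close> and
  \<open>c0\<close>.\<close>

lemma zero_count_bound:
  fixes b :: "nat \<Rightarrow> complex" and G :: "complex \<Rightarrow> complex"
  assumes bd: "\<And>N. norm (\<Sum>n=1..N. b n) \<le> M"
    and hol: "G holomorphic_on {s. Re s > 0}"
    and lim: "\<And>s. Re s > 0 \<Longrightarrow> (\<lambda>N. \<Sum>n=1..N. b n * of_nat n powr (- s)) \<longlonglongrightarrow> G s"
    and growth: "\<And>s. Re s > 0 \<Longrightarrow> norm (G s) \<le> M * norm s * (1 + 1 / Re s)"
    and \<sigma>: "\<sigma> \<ge> 2" and c0: "c0 > 0" and low: "\<And>s. Re s = \<sigma> \<Longrightarrow> norm (G s) \<ge> c0"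
  obtains C where "C > 0"
    "\<And>u T Z m. 0 < u \<Longrightarrow> u \<le> 1 / 2 \<Longrightarrow> T \<ge> 1 \<Longrightarrow> finite Z \<Longrightarrow>
      (\<And>\<rho>. \<rho> \<in> Z \<Longrightarrow> 1 / 2 + u < Re \<rho> \<and> Re \<rho> < \<sigma> \<and> \<bar>Im \<rho>\<bar> \<le> T) \<Longrightarrow>
      (\<And>\<rho>. \<rho> \<in> Z \<Longrightarrow> \<exists>h. h analytic_on {\<rho>} \<and> eventually (\<lambda>s. G s = (s - \<rho>) ^ m \<rho> * h s) (nhds \<rho>)) \<Longrightarrow>
      real (\<Sum>\<rho>\<in>Z. m \<rho>) \<le> C * T * (ln (1 / u) / u)"
proof -
  \<comment> \<open>The reciprocal of \<open>pi / \<sigma> * (c0 / (\<sigma> + 1))^2\<close>, the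
    lower bound for the factor in front of \<open>exp (Y k)\<close> in Jensen's inequality.\<close>
  define A where "A = \<sigma> * (\<sigma> + 1)\<^sup>2 / (pi * c0\<^sup>2)"
  define C where "C = (4 * \<sigma>\<^sup>2 + 1) / 2 * (5 + 2400 * pi * M\<^sup>2 * A)"
  have M: "M \<ge> 0" using bd[of 0] by simp
  have A: "A \<ge> 0" using \<sigma> c0 by (simp add: A_def)
  have C: "C > 0" using A unfolding C_def by (intro mult_pos_pos divide_pos_pos) (auto intro: add_nonneg_pos add_pos_nonneg)
  have main: "real (\<Sum>\<rho>\<in>Z. m \<rho>) \<le> C * T * (ln (1 / u) / u)"
    if u: "0 < u" "u \<le> 1 / 2" and T: "T \<ge> 1" and "finite Z"
      and Z: "\<And>\<rho>. \<rho> \<in> Z \<Longrightarrow> 1 / 2 + u < Re \<rho> \<and> Re \<rho> < \<sigma> \<and> \<bar>Im \<rho>\<bar> \<le> T"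
      and mult: "\<And>\<rho>. \<rho> \<in> Z \<Longrightarrow> \<exists>h. h analytic_on {\<rho>} \<and> eventually (\<lambda>s. G s = (s - \<rho>) ^ m \<rho> * h s) (nhds \<rho>)"
    for u T Z and m :: "complex \<Rightarrow> nat"
  proof -
    \<comment> \<open>Halfway between \<open>1/2\<close> and \<open>1/2 + u\<close>: the mean square
      on this line costs only \<open>1 / u\<close>, and every zero counted lies at least
      \<open>u / 2\<close> to its right.\<close>
    define \<alpha> where "\<alpha> = 1 / 2 + u / 2"
    define d where "d = \<sigma> - \<alpha>"
    have \<alpha>: "\<alpha> > 1 / 2" "\<alpha> \<le> 3 / 4" using u by (auto simp: \<alpha>_def)
    have d: "d \<ge> 1" "d \<le> \<sigma>" using \<alpha> \<sigma> by (auto simp: d_def)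
    define K where "K = nat \<lceil>T\<rceil>"
    have K: "K \<ge> 1" "real K \<ge> T" "real K \<le> 2 * T" using T by (auto simp: K_def) linarith+
    obtain G1 where G1: "G1 holomorphic_on {s. Re s > 0}"
        "\<And>s. Re s > 0 \<Longrightarrow> G s = G1 s * (\<Prod>\<rho>\<in>Z. (s - \<rho>) ^ m \<rho>)"
      using holomorphic_factor_zeros[OF \<open>finite Z\<close> _ open_halfspace_Re_gt hol mult] Z u by force
    define x where "x = (\<lambda>\<rho> k. 4 * d * (Re \<rho> - \<alpha>) / ((d + (Re \<rho> - \<alpha>))\<^sup>2 + (real_of_int k - Im \<rho>)\<^sup>2))"
    define Y where "Y = (\<lambda>k. \<Sum>\<rho>\<in>Z. m \<rho> * x \<rho> k)"
    define g where "g = (\<lambda>t. G (Complex \<alpha> t))"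
    define I where "I = (\<lambda>k. LINT t|lborel. (norm (g t))\<^sup>2 / (1 + (t - real_of_int k)\<^sup>2))"
    have limg: "(\<lambda>N. \<Sum>n=1..N. b n * of_nat n powr (- Complex (1 / 2 + u / 2) t)) \<longlonglongrightarrow> g t" for t
      using lim[of "Complex \<alpha> t"] \<alpha> by (simp add: g_def \<alpha>_def)
    note msq = mean_square_dirichlet_series[OF bd \<open>0 < u\<close> _ limg]
    have gc: "continuous_on UNIV g" unfolding g_def
      by (rule continuous_on_compose2[OF holomorphic_on_imp_continuous_on[OF hol]])
         (use \<alpha> in \<open>auto intro!: continuous_intros\<close>)
    have KT: "1 / 2 + u / 2 \<le> real K" using K u by linarith
    have Ii: "integrable lborel (\<lambda>t. (norm (g t))\<^sup>2 / (1 + (t - real_of_int k)\<^sup>2))"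
      if k: "k \<in> {- int K..int K}" for k
    proof (rule Bochner_Integration.integrable_bound)
      show "integrable lborel (\<lambda>t. 75 * (real K)\<^sup>2 * ((norm (g t))\<^sup>2 / ((real K)\<^sup>2 + t\<^sup>2)))"
        using msq(1)[OF KT] by (rule integrable_mult_right)
      show "(\<lambda>t. (norm (g t))\<^sup>2 / (1 + (t - real_of_int k)\<^sup>2)) \<in> borel_measurable lborel"
        using borel_measurable_continuous_onI[OF gc] by measurable
      show "AE t in lborel. norm ((norm (g t))\<^sup>2 / (1 + (t - real_of_int k)\<^sup>2))
        \<le> norm (75 * (real K)\<^sup>2 * ((norm (g t))\<^sup>2 / ((real K)\<^sup>2 + t\<^sup>2)))"
      proof (rule AE_I2)
        fix t :: real
        have "1 / (1 + (t - of_int k)\<^sup>2) \<le> (\<Sum>k\<in>{- int K..int K}. 1 / (1 + (t - of_int k)\<^sup>2))"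
          by (rule member_le_sum[where f = "\<lambda>k. 1 / (1 + (t - real_of_int k)\<^sup>2)", OF k]) auto
        also note sum_cauchy_weights_le[OF K(1), of t]
        finally have "(norm (g t))\<^sup>2 * (1 / (1 + (t - of_int k)\<^sup>2)) \<le> (norm (g t))\<^sup>2 * (75 * (real K)\<^sup>2 / ((real K)\<^sup>2 + t\<^sup>2))"
          by (rule mult_left_mono) simp
        thus "norm ((norm (g t))\<^sup>2 / (1 + (t - real_of_int k)\<^sup>2))
          \<le> norm (75 * (real K)\<^sup>2 * ((norm (g t))\<^sup>2 / ((real K)\<^sup>2 + t\<^sup>2)))"
          by (simp add: abs_mult mult_ac)
      qed
    qed
    \<comment> \<open>Summing the weights over \<open>k\<close> first leaves the global mean square
      at height \<open>K\<close>, and \<open>1 + 1 / u \<le> 2 / u\<close>.\<close>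
    have Isum: "(\<Sum>k\<in>{- int K..int K}. I k) \<le> 600 * pi * M\<^sup>2 * K / u"
    proof -
      have "(\<Sum>k\<in>{- int K..int K}. I k) = (LINT t|lborel. (\<Sum>k\<in>{- int K..int K}. (norm (g t))\<^sup>2 / (1 + (t - real_of_int k)\<^sup>2)))"
        unfolding I_def using Ii by (rule Bochner_Integration.integral_sum[symmetric])
      also have "\<dots> \<le> (LINT t|lborel. 75 * (real K)\<^sup>2 * ((norm (g t))\<^sup>2 / ((real K)\<^sup>2 + t\<^sup>2)))"
      proof (rule integral_mono)
        show "integrable lborel (\<lambda>t. \<Sum>k\<in>{- int K..int K}. (norm (g t))\<^sup>2 / (1 + (t - real_of_int k)\<^sup>2))"
          using Ii by (rule Bochner_Integration.integrable_sum)
        show "integrable lborel (\<lambda>t. 75 * (real K)\<^sup>2 * ((norm (g t))\<^sup>2 / ((real K)\<^sup>2 + t\<^sup>2)))"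
          using msq(1)[OF KT] by (rule integrable_mult_right)
        fix t :: real
        have "(\<Sum>k\<in>{- int K..int K}. (norm (g t))\<^sup>2 / (1 + (t - real_of_int k)\<^sup>2)) =
           (norm (g t))\<^sup>2 * (\<Sum>k\<in>{- int K..int K}. 1 / (1 + (t - of_int k)\<^sup>2))"
          by (simp add: sum_distrib_left)
        also have "\<dots> \<le> (norm (g t))\<^sup>2 * (75 * (real K)\<^sup>2 / ((real K)\<^sup>2 + t\<^sup>2))"
          by (intro mult_left_mono sum_cauchy_weights_le K) simp
        finally show "(\<Sum>k\<in>{- int K..int K}. (norm (g t))\<^sup>2 / (1 + (t - real_of_int k)\<^sup>2)) \<le>
           75 * (real K)\<^sup>2 * ((norm (g t))\<^sup>2 / ((real K)\<^sup>2 + t\<^sup>2))" by (simp add: mult_ac)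
      qed
      also have "\<dots> = 75 * (real K)\<^sup>2 * (LINT t|lborel. (norm (g t))\<^sup>2 / ((real K)\<^sup>2 + t\<^sup>2))"
        by (rule integral_mult_right_zero)
      also have "\<dots> \<le> 75 * (real K)\<^sup>2 * (4 * pi * M\<^sup>2 * (1 + 1 / u) / real K)"
        by (intro mult_left_mono msq(2)[OF KT]) auto
      also have "\<dots> = 300 * pi * M\<^sup>2 * K * (1 + 1 / u)"
        using K by (simp add: power2_eq_square)
      also have "\<dots> \<le> 300 * pi * M\<^sup>2 * K * (2 / u)"
        using u by (intro mult_left_mono) (auto simp: field_simps)
      finally show ?thesis by simp
    qed
    \<comment> \<open>Dividing \<open>G\<close> by \<open>w\<close>, of modulus at least 1, makes it bounded. Jensen's inequality then bounds
      \<open>exp (Y k)\<close>, and the tangent line of \<open>ln\<close> at \<open>1 / u\<close> replaces concavity when summing over \<open>k\<close>.\<close>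
    have Yk: "Y k \<le> ln (1 / u) + u * A * I k" if k: "k \<in> {- int K..int K}" for k
    proof -
      \<comment> \<open>Placing the zero of \<open>w\<close> at height \<open>k\<close> gives
        \<open>w\<close> the value \<open>\<sigma> + 1\<close> at \<open>Complex \<sigma> k\<close>,
        so the lower bound there is uniform in \<open>k\<close>.\<close>
      define w where "w = (\<lambda>s. s - Complex (-1) (of_int k))"
      have w: "norm (w s) \<ge> 1" "w s \<noteq> 0" if "Re s > 0" for s
      proof -
        have "1 \<le> \<bar>Re (w s)\<bar>" using that by (simp add: w_def)
        thus "norm (w s) \<ge> 1" using abs_Re_le_cmod order_trans by blast
        thus "w s \<noteq> 0" by auto
      qed
      have "pi / d * (norm (G (Complex (\<alpha> + d) (of_int k)) / w (Complex (\<alpha> + d) (of_int k))))\<^sup>2 * exp (Y k)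
         \<le> (LINT t|lborel. (norm (G (Complex \<alpha> t) / w (Complex \<alpha> t)))\<^sup>2 / (d\<^sup>2 + (t - of_int k)\<^sup>2))"
        unfolding Y_def x_def
      proof (rule jensen_half_plane[where c = 0 and ?f1.0 = "\<lambda>s. G1 s / w s" and M = "3 * M * (\<bar>of_int k\<bar> + 2)"])
        show "(\<lambda>s. G1 s / w s) holomorphic_on {s. Re s > 0}"
          using w unfolding w_def by (intro holomorphic_intros G1) auto
        show "G s / w s = G1 s / w s * (\<Prod>\<rho>\<in>Z. (s - \<rho>) ^ m \<rho>)" if "Re s > 0" for s
          using G1(2)[OF that] by simp
        show "norm (G s / w s) \<le> 3 * M * (\<bar>of_int k\<bar> + 2)" if s: "\<alpha> \<le> Re s" for s
        proof -
          have s0: "Re s > 0" "Re s \<ge> 1 / 2" using s \<alpha> by auto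
          have "norm (Complex (-1) (of_int k)) \<le> \<bar>of_int k\<bar> + 1"
            using cmod_le[of "Complex (-1) (of_int k)"] by simp
          moreover have "norm s \<le> norm (w s) + norm (Complex (-1) (of_int k))"
            unfolding w_def by (metis norm_triangle_sub add.commute)
          ultimately have "norm s \<le> norm (w s) + (\<bar>of_int k\<bar> + 1) * 1" by simp
          also have "\<dots> \<le> norm (w s) + (\<bar>of_int k\<bar> + 1) * norm (w s)"
            using w(1)[OF s0(1)] by (intro add_left_mono mult_left_mono) auto
          finally have ws: "norm s \<le> (\<bar>of_int k\<bar> + 2) * norm (w s)" by (simp add: algebra_simps)
          have "1 + 1 / Re s \<le> 3" using s0 by (simp add: field_simps)
          hence "norm (G s) \<le> M * norm s * 3"
            using growth[OF s0(1)] M mult_left_mono[of "1 + 1 / Re s" 3 "M * norm s"] by force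
          also have "\<dots> \<le> M * ((\<bar>of_int k\<bar> + 2) * norm (w s)) * 3"
            using M ws by (intro mult_right_mono mult_left_mono) auto
          finally show ?thesis
            using w[OF s0(1)] by (simp add: norm_divide pos_divide_le_eq algebra_simps)
        qed
      qed (use \<alpha> d Z u \<open>finite Z\<close> in \<open>force simp: \<alpha>_def\<close>)+
      also have "\<dots> \<le> I k"
        unfolding I_def
      proof (rule integral_mono_AE')
        show "integrable lborel (\<lambda>t. (norm (g t))\<^sup>2 / (1 + (t - real_of_int k)\<^sup>2))" by (rule Ii[OF k])
        show "AE t in lborel. (norm (G (Complex \<alpha> t) / w (Complex \<alpha> t)))\<^sup>2 / (d\<^sup>2 + (t - of_int k)\<^sup>2)
           \<le> (norm (g t))\<^sup>2 / (1 + (t - real_of_int k)\<^sup>2)"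
        proof (rule AE_I2)
          fix t :: real
          have "norm (G (Complex \<alpha> t) / w (Complex \<alpha> t)) \<le> norm (g t)"
            using w[of "Complex \<alpha> t"] \<alpha> mult_left_mono[of 1 "norm (w (Complex \<alpha> t))" "norm (g t)"]
            by (simp add: norm_divide g_def pos_divide_le_eq)
          moreover have "d\<^sup>2 \<ge> 1" using d by simp
          ultimately show "(norm (G (Complex \<alpha> t) / w (Complex \<alpha> t)))\<^sup>2 / (d\<^sup>2 + (t - of_int k)\<^sup>2)
           \<le> (norm (g t))\<^sup>2 / (1 + (t - real_of_int k)\<^sup>2)"
            by (intro frac_le power_mono) (auto intro: add_pos_nonneg)
        qed
      qed auto
      finally have J: "pi / d * (norm (G (Complex \<sigma> (of_int k)) / w (Complex \<sigma> (of_int k))))\<^sup>2 * exp (Y k) \<le> I k"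
        by (simp add: d_def)
      have "w (Complex \<sigma> (of_int k)) = of_real (\<sigma> + 1)" by (simp add: w_def complex_eq_iff)
      hence "norm (w (Complex \<sigma> (of_int k))) = \<sigma> + 1" using \<sigma> by (simp del: of_real_add)
      hence "norm (G (Complex \<sigma> (of_int k)) / w (Complex \<sigma> (of_int k))) \<ge> c0 / (\<sigma> + 1)"
        using low[of "Complex \<sigma> (of_int k)"] \<sigma> by (simp add: norm_divide divide_right_mono)
      hence "pi / \<sigma> * (c0 / (\<sigma> + 1))\<^sup>2 \<le> pi / d * (norm (G (Complex \<sigma> (of_int k)) / w (Complex \<sigma> (of_int k))))\<^sup>2"
        using d c0 \<sigma> by (intro mult_mono power_mono divide_left_mono) auto
      hence "pi / \<sigma> * (c0 / (\<sigma> + 1))\<^sup>2 * exp (Y k) \<le> I k"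
        using J mult_right_mono order_trans by (metis exp_ge_zero)
      moreover have "A * (pi / \<sigma> * (c0 / (\<sigma> + 1))\<^sup>2) = 1"
        using \<sigma> c0 by (simp add: A_def power_divide)
      ultimately have "exp (Y k) \<le> A * I k"
        using mult_left_mono[OF _ A] by (metis mult.assoc mult_1)
      hence "u * exp (Y k) \<le> u * A * I k" using u by simp
      moreover have "1 + (Y k - ln (1 / u)) \<le> exp (Y k - ln (1 / u))" by (rule exp_ge_add_one_self)
      moreover have "exp (Y k - ln (1 / u)) = u * exp (Y k)" using u by (simp add: exp_diff)
      ultimately show ?thesis by linarith
    qed
    \<comment> \<open>A lower bound for the total weight of a zero, already reached by the single
      integer \<open>k\<close> below \<open>Im \<rho>\<close>: there the numerator is at least
      \<open>2 * u\<close>, and the denominator at most \<open>(2 * \<sigma>)^2 + 1\<close>.\<close>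
    define v where "v = 2 * u / (4 * \<sigma>\<^sup>2 + 1)"
    have v: "v > 0" using u by (simp add: v_def add_nonneg_pos)
    have x0: "x \<rho> k \<ge> 0" if "\<rho> \<in> Z" for \<rho> k
      using Z[OF that] d u by (auto simp: x_def \<alpha>_def)
    have xv: "v \<le> (\<Sum>k\<in>{- int K..int K}. x \<rho> k)" if \<rho>: "\<rho> \<in> Z" for \<rho>
    proof -
      define k where "k = \<lfloor>Im \<rho>\<rfloor>"
      define \<delta> where "\<delta> = Re \<rho> - \<alpha>"
      have \<delta>: "\<delta> \<ge> u / 2" "\<delta> \<le> \<sigma>" using Z[OF \<rho>] \<alpha> by (auto simp: \<delta>_def \<alpha>_def)
      have "k \<in> {- int K..int K}"
        using Z[OF \<rho>] K unfolding k_def by (auto simp: le_floor_iff floor_le_iff)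
      have "\<bar>of_int k - Im \<rho>\<bar> \<le> 1" unfolding k_def by linarith
      hence "(of_int k - Im \<rho>)\<^sup>2 \<le> 1" by (simp add: abs_square_le_1)
      moreover have "(d + \<delta>)\<^sup>2 \<le> (2 * \<sigma>)\<^sup>2" using d \<delta> u by (intro power_mono) auto
      ultimately have "(d + \<delta>)\<^sup>2 + (of_int k - Im \<rho>)\<^sup>2 \<le> 4 * \<sigma>\<^sup>2 + 1" by simp
      moreover have "4 * 1 * (u / 2) \<le> 4 * d * \<delta>" using d \<delta> u by (intro mult_mono) auto
      moreover have "(d + \<delta>)\<^sup>2 + (of_int k - Im \<rho>)\<^sup>2 > 0" using d \<delta> u by (intro add_pos_nonneg) auto
      ultimately have "v \<le> x \<rho> k" unfolding v_def x_def \<delta>_def[symmetric]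
        using d \<delta> u by (intro frac_le) auto
      also have "\<dots> \<le> (\<Sum>k\<in>{- int K..int K}. x \<rho> k)"
        by (rule member_le_sum[where f = "x \<rho>", OF \<open>k \<in> {- int K..int K}\<close>]) (use x0[OF \<rho>] in auto)
      finally show ?thesis .
    qed
    define l where "l = ln (1 / u)"
    \<comment> \<open>Bounding \<open>l\<close> away from \<open>0\<close> allows the terms without
      a logarithm to be absorbed into \<open>T * l\<close>.\<close>
    have l: "l \<ge> 1 / 2"
      unfolding l_def using u ln_le_minus_one[of u] by (simp add: ln_div)
    \<comment> \<open>Double counting: the weights of all zeros are summed over \<open>k\<close>,
      and the order of summation is exchanged to reach the bounds for \<open>Y k\<close>.\<close>
    have "real (\<Sum>\<rho>\<in>Z. m \<rho>) * v = (\<Sum>\<rho>\<in>Z. m \<rho> * v)" by (simp add: sum_distrib_right)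
    also have "\<dots> \<le> (\<Sum>\<rho>\<in>Z. m \<rho> * (\<Sum>k\<in>{- int K..int K}. x \<rho> k))"
      by (intro sum_mono mult_left_mono xv) auto
    also have "\<dots> = (\<Sum>k\<in>{- int K..int K}. Y k)"
      unfolding Y_def sum_distrib_left by (rule sum.swap)
    also have "\<dots> \<le> (\<Sum>k\<in>{- int K..int K}. l + u * A * I k)"
      unfolding l_def by (intro sum_mono Yk)
    also have "\<dots> = (2 * real K + 1) * l + u * A * (\<Sum>k\<in>{- int K..int K}. I k)"
      by (simp add: sum.distrib sum_distrib_left)
    also have "\<dots> \<le> (2 * real K + 1) * l + u * A * (600 * pi * M\<^sup>2 * K / u)"
      using A u by (intro add_left_mono mult_left_mono Isum) auto
    also have "\<dots> = (2 * real K + 1) * l + 600 * pi * M\<^sup>2 * A * K" using u by simp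
    also have "\<dots> \<le> (5 * T) * l + 600 * pi * M\<^sup>2 * A * (4 * T * l)"
    proof (intro add_mono mult_right_mono mult_left_mono)
      have "2 * T * (1 / 2) \<le> 2 * T * l" using l T by (intro mult_left_mono) auto
      thus "real K \<le> 4 * T * l" using K by linarith
    qed (use K T l A in auto)
    also have "\<dots> = (5 + 2400 * pi * M\<^sup>2 * A) * T * l" by (simp add: algebra_simps)
    finally have "real (\<Sum>\<rho>\<in>Z. m \<rho>) \<le> (5 + 2400 * pi * M\<^sup>2 * A) * T * l / v"
      using v by (simp add: pos_le_divide_eq)
    also have "\<dots> = C * T * (l / u)" using u by (simp add: v_def C_def)
    finally show ?thesis by (simp add: l_def)
  qed
  show ?thesis using that[OF C main] by blast
qed

subsection \<open>Periodic coefficients\<close>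

lemma periodic_imp_mod_eq:
  fixes f :: "nat \<Rightarrow> 'a" and p :: nat
  assumes "\<And>n. f (n + p) = f n"
  shows "f n = f (n mod p)"
proof -
  have "f (m + p * k) = f m" for m k
  proof (induction k)
    case (Suc k)
    thus ?case using assms[of "m + p * k"] by (simp add: algebra_simps)
  qed simp
  from this[of "n mod p" "n div p"] show ?thesis by simp
qed

lemma sum_if_even_eq:
  fixes f :: "nat \<Rightarrow> 'a::comm_monoid_add"
  shows "(\<Sum>n=1..N. if even n then f (n div 2) else 0) = (\<Sum>n=1..N div 2. f n)"
proof (induction N)
  case (Suc N)
  show ?case
  proof (cases "even (Suc N)")
    case True
    then obtain k where "Suc N = 2 * k" by blast
    then obtain j where "N = Suc (2 * j)" by (cases k) auto
    thus ?thesis using Suc by simp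
  next
    case False
    hence "Suc N div 2 = N div 2" by (auto elim!: evenE)
    thus ?thesis using Suc False by simp
  qed
qed simp

text \<open>The partial sums \<open>A\<close> of \<open>a\<close> grow by \<open>A q\<close> over
  each period, and \<open>B N = A N - 2 * A (N div 2)\<close>. A shift by \<open>2 * q\<close> adds
  \<open>2 * A q\<close> to both terms, so \<open>B\<close> is periodic and hence bounded.\<close>

lemma bounded_partial_sums_periodic:
  fixes a :: "nat \<Rightarrow> complex"
  assumes per: "\<And>n. n \<ge> 1 \<Longrightarrow> a (n + q) = a n" and "q \<ge> 1"
  obtains M where "\<And>N. norm (\<Sum>n=1..N. a n - (if even n then 2 * a (n div 2) else 0)) \<le> M"
proof -
  define A where "A = (\<lambda>N. \<Sum>n=1..N. a n)"
  define B where "B = (\<lambda>N. \<Sum>n=1..N. a n - (if even n then 2 * a (n div 2) else 0))"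
  have A: "A (N + q) = A N + A q" for N
  proof (induction N)
    case (Suc N)
    thus ?case using per[of "Suc N"] by (simp add: A_def)
  qed (simp add: A_def)
  have B: "B N = A N - 2 * A (N div 2)" for N
    using sum_if_even_eq[of "\<lambda>n. 2 * a n" N]
    by (simp add: B_def A_def sum_subtractf sum_distrib_left)
  have "B (N + 2 * q) = B N" for N
  proof -
    have "A (N + 2 * q) = A ((N + q) + q)" by (rule arg_cong[of _ _ A]) simp
    also have "\<dots> = A N + 2 * A q" unfolding A by simp
    finally have "A (N + 2 * q) = A N + 2 * A q" .
    moreover have "(N + 2 * q) div 2 = N div 2 + q" by simp
    ultimately show ?thesis unfolding B by (simp only: A) simp
  qed
  hence mod: "B N = B (N mod (2 * q))" for N by (rule periodic_imp_mod_eq[of B "2 * q"])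
  have "norm (B N) \<le> (\<Sum>i<2 * q. norm (B i))" for N
  proof -
    have "norm (B (N mod (2 * q))) \<le> (\<Sum>i<2 * q. norm (B i))"
      by (rule member_le_sum[of _ _ "\<lambda>i. norm (B i)"]) (use \<open>q \<ge> 1\<close> in auto)
    thus ?thesis using mod[of N] by simp
  qed
  thus ?thesis unfolding B_def by (rule that)
qed

section \<open>Transfer of zeros from the continuation to the auxiliary series\<close>

text \<open>Multiplication by \<open>2 powr (1 - s)\<close> sends the term of index \<open>m\<close>
  to index \<open>2 * m\<close> with coefficient \<open>2 * a m\<close>, so the partial sum up to
  \<open>N\<close> involves the original one only up to \<open>N div 2\<close>.\<close>

lemma dirichlet_continuation_relation:
  assumes F: "is_dirichlet_continuation a F" and s: "Re s > 1"
  shows "(\<lambda>N. \<Sum>n=1..N. (a n - (if even n then 2 * a (n div 2) else 0)) * of_nat n powr (- s))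
           \<longlonglongrightarrow> (1 - 2 powr (1 - s)) * F s"
proof -
  define D where "D = (\<lambda>N. \<Sum>n=1..N. a n * of_nat n powr (- s))"
  have "(\<lambda>n. a (Suc n) * of_nat (Suc n) powr (- s)) sums F s"
    using F s by (auto simp: is_dirichlet_continuation_def)
  moreover have "(\<Sum>n<N. a (Suc n) * of_nat (Suc n) powr (- s)) = D N" for N
    by (simp add: D_def sum.atLeast1_atMost_eq)
  ultimately have D: "D \<longlonglongrightarrow> F s" by (simp add: sums_def)
  have div2: "filterlim (\<lambda>N::nat. N div 2) sequentially sequentially"
    unfolding filterlim_at_top eventually_sequentially
    by (metis div_le_mono div_mult_self_is_m mult.commute zero_less_numeral)
  have eqn: "(\<Sum>n=1..N. (a n - (if even n then 2 * a (n div 2) else 0)) * of_nat n powr (- s)) =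
     D N - 2 powr (1 - s) * D (N div 2)" for N
  proof -
    have "(\<Sum>n=1..N. (a n - (if even n then 2 * a (n div 2) else 0)) * of_nat n powr (- s)) =
      D N - (\<Sum>n=1..N. if even n then 2 powr (1 - s) * (a (n div 2) * of_nat (n div 2) powr (- s)) else 0)"
      unfolding D_def sum_subtractf[symmetric]
    proof (intro sum.cong refl)
      fix n assume "n \<in> {1..N}"
      show "(a n - (if even n then 2 * a (n div 2) else 0)) * of_nat n powr (- s) =
        a n * of_nat n powr (- s) - (if even n then 2 powr (1 - s) * (a (n div 2) * of_nat (n div 2) powr (- s)) else 0)"
      proof (cases "even n")
        case True
        define m where "m = n div 2"
        have m: "n = 2 * m" using True by (simp add: m_def)
        have two: "2 powr (1 - s) = 2 * 2 powr (- s)" by (simp add: powr_diff powr_minus field_simps)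
        have "complex_of_nat n powr (- s) = (of_real 2 * of_real (real m)) powr (- s)"
          by (simp add: m)
        also have "\<dots> = 2 powr (- s) * of_nat m powr (- s)"
          by (subst powr_times_real) auto
        finally show ?thesis using True unfolding two m_def[symmetric] by (simp add: algebra_simps)
      qed simp
    qed
    also have "(\<Sum>n=1..N. if even n then 2 powr (1 - s) * (a (n div 2) * of_nat (n div 2) powr (- s)) else 0) =
      2 powr (1 - s) * D (N div 2)"
      unfolding D_def sum_distrib_left by (rule sum_if_even_eq)
    finally show ?thesis .
  qed
  have "(1 - 2 powr (1 - s)) * F s = F s - 2 powr (1 - s) * F s" by (simp add: algebra_simps)
  moreover have "(\<lambda>N. D N - 2 powr (1 - s) * D (N div 2)) \<longlonglongrightarrow> F s - 2 powr (1 - s) * F s"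
    by (intro tendsto_intros D filterlim_compose[OF D div2])
  ultimately show ?thesis by (simp only: eqn)
qed

text \<open>The identity theorem for the meromorphic function \<open>G - p * F\<close>, which
  vanishes for \<open>Re s > 1\<close>. A point where \<open>F\<close> tends to \<open>0\<close> is
  not a pole, so the relation holds there pointwise.\<close>

lemma meromorphic_eq_near:
  fixes F G :: "complex \<Rightarrow> complex"
  assumes F: "F nicely_meromorphic_on UNIV" and G: "G holomorphic_on {s. Re s > 0}"
    and p: "\<And>s. p analytic_on {s}"
    and eq: "\<And>s. Re s > 1 \<Longrightarrow> G s = p s * F s" and \<rho>: "Re \<rho> > 0" "F \<midarrow>\<rho>\<rightarrow> 0"
  shows "F analytic_on {\<rho>}" "eventually (\<lambda>s. G s = p s * F s) (nhds \<rho>)"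
proof -
  define H where "H = (\<lambda>s. G s - p s * F s)"
  have Gan: "G analytic_on {s}" if "Re s > 0" for s
    using G that open_halfspace_Re_gt analytic_at by blast
  have "\<not> is_pole F \<rho>"
    using \<rho>(2) unfolding is_pole_def by (meson not_tendsto_and_filterlim_at_infinity at_neq_bot)
  thus Fan: "F analytic_on {\<rho>}"
    using nicely_meromorphic_on_imp_analytic_at[OF F] by blast
  have Hm: "H meromorphic_on {s. Re s > 0}"
  proof -
    have "G meromorphic_on {s. Re s > 0}"
      using Gan analytic_on_analytic_at by (intro analytic_on_imp_meromorphic_on) blast
    moreover have "p meromorphic_on {s. Re s > 0}"
      using p analytic_on_analytic_at by (intro analytic_on_imp_meromorphic_on) blast
    moreover have "F meromorphic_on {s. Re s > 0}"
      using F meromorphic_on_subset unfolding nicely_meromorphic_on_def by blast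
    ultimately show ?thesis unfolding H_def by (intro meromorphic_on_diff meromorphic_on_mult)
  qed
  \<comment> \<open>\<open>H\<close> itself can be non-zero at a pole of \<open>F\<close>, where
    \<open>F\<close> has the default value \<open>0\<close>; only after removing singularities is it
    identically \<open>0\<close>.\<close>
  have rs0: "remove_sings H s = 0" if "Re s > 0" for s
  proof (rule frequently_eq_meromorphic_imp_constant[where f = "remove_sings H" and z = 2 and A = "{s. Re s > 0}"])
    show "frequently (\<lambda>s. remove_sings H s = 0) (at 2)"
    proof (rule eventually_frequently)
      have ev: "eventually (\<lambda>s::complex. s \<in> {s. Re s > 1}) (at 2)"
        by (intro eventually_at_in_open' open_halfspace_Re_gt) auto
      have "H meromorphic_on {2}" using Hm by (rule meromorphic_on_subset) auto
      hence "eventually (\<lambda>s. remove_sings H s = H s) (at 2)"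
        by (intro eventually_remove_sings_eq_at meromorphic_on_isolated_singularity)
      thus "eventually (\<lambda>s. remove_sings H s = 0) (at 2)"
        using ev by eventually_elim (auto simp: H_def eq)
    qed simp
    show "remove_sings H nicely_meromorphic_on {s. Re s > 0}"
      using Hm by (rule remove_sings_nicely_meromorphic)
    show "connected {s. Re s > 0}" by (intro convex_connected convex_halfspace_Re_gt)
  qed (use that in \<open>auto simp: open_halfspace_Re_gt\<close>)
  have "eventually (\<lambda>s. F analytic_on {s}) (nhds \<rho>)"
  proof -
    obtain S where S: "open S" "\<rho> \<in> S" "F holomorphic_on S" using Fan analytic_at by blast
    from eventually_nhds_in_open[OF S(1,2)] show ?thesis
      by eventually_elim (use S analytic_at in blast)
  qed
  moreover have "eventually (\<lambda>s. s \<in> {s. Re s > 0}) (nhds \<rho>)"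
    using \<rho>(1) by (intro eventually_nhds_in_open open_halfspace_Re_gt) auto
  ultimately show "eventually (\<lambda>s. G s = p s * F s) (nhds \<rho>)"
  proof eventually_elim
    case (elim s)
    have "H analytic_on {s}" unfolding H_def
      by (intro analytic_intros elim p Gan) (use elim in auto)
    hence "H s = 0" using rs0[of s] elim by simp
    thus ?case by (simp add: H_def)
  qed
qed

text \<open>The point \<open>w0\<close> shows that \<open>G\<close> is not identically zero, hence
  \<open>F\<close> is not zero near \<open>\<rho>\<close> and its order there is positive and
  finite. The cofactor \<open>h\<close> is \<open>p\<close> times the local cofactor of
  \<open>F\<close>.\<close>

lemma zero_local_factorization:
  fixes F G :: "complex \<Rightarrow> complex"
  assumes F: "F nicely_meromorphic_on UNIV" and G: "G holomorphic_on {s. Re s > 0}"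
    and p: "\<And>s. p analytic_on {s}"
    and eq: "\<And>s. Re s > 1 \<Longrightarrow> G s = p s * F s" and \<rho>: "Re \<rho> > 0" "F \<midarrow>\<rho>\<rightarrow> 0"
    and nz: "Re w0 > 0" "G w0 \<noteq> 0"
  shows "zorder F \<rho> > 0" "G \<rho> = 0"
    "\<exists>h. h analytic_on {\<rho>} \<and> eventually (\<lambda>s. G s = (s - \<rho>) ^ nat (zorder F \<rho>) * h s) (nhds \<rho>)"
proof -
  have near: "F analytic_on {\<rho>}" "eventually (\<lambda>s. G s = p s * F s) (nhds \<rho>)"
    by (rule meromorphic_eq_near[where G = G and p = p]; use F G p eq \<rho> in blast)+
  have F0: "F \<rho> = 0"
    using analytic_at_imp_isCont[OF near(1)] \<rho>(2) LIM_unique unfolding isCont_def by blast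
  show "G \<rho> = 0" using eventually_nhds_x_imp_x[OF near(2)] F0 by simp
  obtain r where r: "r > 0" "F holomorphic_on ball \<rho> r" "\<And>s. s \<in> ball \<rho> r \<Longrightarrow> G s = p s * F s"
  proof -
    obtain S where S: "open S" "\<rho> \<in> S" "F holomorphic_on S" using near(1) analytic_at by blast
    have "eventually (\<lambda>s. s \<in> S \<and> G s = p s * F s) (nhds \<rho>)"
      using near(2) eventually_nhds_in_open[OF S(1,2)] by eventually_elim auto
    then obtain r where "r > 0" "\<And>s. dist s \<rho> < r \<Longrightarrow> s \<in> S \<and> G s = p s * F s"
      unfolding eventually_nhds_metric by blast
    thus ?thesis using that[of r] S(3) holomorphic_on_subset[of F S "ball \<rho> r"]
      by (auto simp: dist_commute subset_iff)
  qed
  \<comment> \<open>Otherwise \<open>G = p * F\<close> would vanish on a disc and so, by analytic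
    continuation, at \<open>w0\<close>.\<close>
  have "\<exists>w\<in>ball \<rho> r. F w \<noteq> 0"
  proof (rule ccontr)
    assume "\<not> ?thesis"
    hence G0: "G s = 0" if "s \<in> ball \<rho> r" for s using r(3)[OF that] that by auto
    have "G w0 = 0"
    proof (rule analytic_continuation_open[of "ball \<rho> r \<inter> {s. Re s > 0}" "{s. Re s > 0}" G "\<lambda>_. 0"])
      show "ball \<rho> r \<inter> {s. 0 < Re s} \<noteq> {}" using r(1) \<rho>(1) centre_in_ball by blast
      show "connected {s. Re s > 0}" by (intro convex_connected convex_halfspace_Re_gt)
    qed (use G G0 nz in \<open>auto simp: open_halfspace_Re_gt\<close>)
    with nz show False by simp
  qed
  from zorder_exist_zero[OF r(2) open_ball connected_ball _ this] r(1) F0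
  have "zorder F \<rho> > 0" and "\<exists>r'>0. cball \<rho> r' \<subseteq> ball \<rho> r \<and> zor_poly F \<rho> holomorphic_on cball \<rho> r' \<and>
     (\<forall>w\<in>cball \<rho> r'. F w = zor_poly F \<rho> w * (w - \<rho>) ^ nat (zorder F \<rho>) \<and> zor_poly F \<rho> w \<noteq> 0)"
    by auto
  then obtain r' where r': "r' > 0" "cball \<rho> r' \<subseteq> ball \<rho> r" "zor_poly F \<rho> holomorphic_on cball \<rho> r'"
    "\<And>w. w \<in> cball \<rho> r' \<Longrightarrow> F w = zor_poly F \<rho> w * (w - \<rho>) ^ nat (zorder F \<rho>)"
    by blast
  show "zorder F \<rho> > 0" by fact
  show "\<exists>h. h analytic_on {\<rho>} \<and> eventually (\<lambda>s. G s = (s - \<rho>) ^ nat (zorder F \<rho>) * h s) (nhds \<rho>)"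
  proof (intro exI conjI)
    have "zor_poly F \<rho> analytic_on {\<rho>}"
      using r'(1) holomorphic_on_subset[OF r'(3) ball_subset_cball] analytic_at by (metis centre_in_ball open_ball)
    thus "(\<lambda>s. p s * zor_poly F \<rho> s) analytic_on {\<rho>}" by (intro analytic_intros p)
    have "eventually (\<lambda>s. s \<in> ball \<rho> r') (nhds \<rho>)"
      using r'(1) by (intro eventually_nhds_in_open) auto
    thus "eventually (\<lambda>s. G s = (s - \<rho>) ^ nat (zorder F \<rho>) * (p s * zor_poly F \<rho> s)) (nhds \<rho>)"
    proof eventually_elim
      case (elim s)
      hence "s \<in> cball \<rho> r'" by auto
      with r'(2) show ?case using r(3)[of s] r'(4)[of s] by (auto simp: mult_ac)
    qed
  qed
qed

section \<open>The zero count for periodic coefficients\<close>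

theorem theorem3:
  fixes a :: "nat \<Rightarrow> complex"
  assumes "periodic_seq a" and "nonzero_seq a"
  shows "\<exists>C::real. C > 0 \<and>
    (\<forall>F. is_dirichlet_continuation a F \<longrightarrow>
      (\<forall>u T. 0 < u \<longrightarrow> u \<le> 1 / 2 \<longrightarrow> 1 \<le> T \<longrightarrow>
        ereal_of_enat (zero_count F (1 / 2 + u) \<infinity> T) \<le> ereal (C * T * (ln (1 / u) / u))))"
proof -
  \<comment> \<open>The coefficients of \<open>(1 - 2 powr (1 - s)) * F s\<close>.\<close>
  define b where "b = (\<lambda>n. a n - (if even n then 2 * a (n div 2) else 0))"
  obtain q where q: "q \<ge> 1" "\<And>n. n \<ge> 1 \<Longrightarrow> a (n + q) = a n"
    using assms(1) by (auto simp: periodic_seq_def)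
  obtain M where M: "\<And>N. norm (\<Sum>n=1..N. b n) \<le> M"
    unfolding b_def by (rule bounded_partial_sums_periodic[of a q]) (use q in blast)+
  obtain G where G: "G holomorphic_on {s. Re s > 0}"
    and lim: "\<And>s. Re s > 0 \<Longrightarrow> (\<lambda>N. \<Sum>n=1..N. b n * of_nat n powr (- s)) \<longlonglongrightarrow> G s"
    and growth: "\<And>s. Re s > 0 \<Longrightarrow> norm (G s) \<le> M * norm s * (1 + 1 / Re s)"
    using dirichlet_series_bounded_partial_sums[where b = b, OF M] by blast
  define n0 where "n0 = (LEAST n. n \<ge> 1 \<and> a n \<noteq> 0)"
  have n0: "n0 \<ge> 1" "a n0 \<noteq> 0"
    using LeastI_ex[of "\<lambda>n. n \<ge> 1 \<and> a n \<noteq> 0"] assms(2) by (auto simp: n0_def nonzero_seq_def)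
  have least: "a n = 0" if "1 \<le> n" "n < n0" for n
    using not_less_Least[of n "\<lambda>n. n \<ge> 1 \<and> a n \<noteq> 0"] that by (auto simp: n0_def)
  \<comment> \<open>Since \<open>n div 2 < n0\<close> for even \<open>n\<close> up to
    \<open>n0\<close>, passing from \<open>a\<close> to \<open>b\<close> changes neither the first
    non-zero index nor the coefficient there.\<close>
  have half: "a (n div 2) = 0" if "1 \<le> n" "n \<le> n0" "even n" for n
    using that by (intro least) (auto elim!: evenE)
  have b: "b n0 \<noteq> 0" "\<And>n. 1 \<le> n \<Longrightarrow> n < n0 \<Longrightarrow> b n = 0"
    using n0 half least by (auto simp: b_def)
  have bM: "norm (b n) \<le> 2 * M" if "n \<ge> 1" for n
  proof -
    have "b n = (\<Sum>k=1..n. b k) - (\<Sum>k=1..n - 1. b k)"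
      using that by (cases n) auto
    thus ?thesis using norm_triangle_ineq4[of "\<Sum>k=1..n. b k" "\<Sum>k=1..n - 1. b k"] M[of n] M[of "n - 1"] by simp
  qed
  obtain \<sigma> where \<sigma>: "\<sigma> \<ge> 2" "\<And>s. Re s \<ge> \<sigma> \<Longrightarrow> norm (G s) \<ge> norm (b n0) * real n0 powr (- Re s) / 2"
    by (rule dirichlet_series_lower_bound[of b "2 * M" n0 G]) (use bM n0 b lim in blast)+
  \<comment> \<open>This confines the zeros to \<open>Re s < \<sigma>\<close>, so the count up to
    infinity reduces to a strip.\<close>
  have G_nz: "G s \<noteq> 0" if "Re s \<ge> \<sigma>" for s
  proof -
    have "norm (b n0) * real n0 powr (- Re s) / 2 > 0" using b n0 by simp
    thus ?thesis using \<sigma>(2)[OF that] by auto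
  qed
  have c0: "norm (b n0) * real n0 powr (- \<sigma>) / 2 > 0" using b n0 by simp
  \<comment> \<open>\<open>C\<close> is fixed before \<open>F\<close>: it comes from
    \<open>G\<close>, which is built from \<open>a\<close> alone.\<close>
  obtain C where C: "C > 0"
    "\<And>u T Z m. 0 < u \<Longrightarrow> u \<le> 1 / 2 \<Longrightarrow> T \<ge> 1 \<Longrightarrow> finite Z \<Longrightarrow>
      (\<And>\<rho>. \<rho> \<in> Z \<Longrightarrow> 1 / 2 + u < Re \<rho> \<and> Re \<rho> < \<sigma> \<and> \<bar>Im \<rho>\<bar> \<le> T) \<Longrightarrow>
      (\<And>\<rho>. \<rho> \<in> Z \<Longrightarrow> \<exists>h. h analytic_on {\<rho>} \<and> eventually (\<lambda>s. G s = (s - \<rho>) ^ m \<rho> * h s) (nhds \<rho>)) \<Longrightarrow>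
      real (\<Sum>\<rho>\<in>Z. m \<rho>) \<le> C * T * (ln (1 / u) / u)"
  proof (rule zero_count_bound[of b M G \<sigma>])
    show "norm (b n0) * real n0 powr (- \<sigma>) / 2 \<le> norm (G s)" if "Re s = \<sigma>" for s
      using \<sigma>(2)[of s] that by simp
  qed (use M G lim growth \<sigma>(1) c0 in blast)+
  have "ereal_of_enat (zero_count F (1 / 2 + u) \<infinity> T) \<le> ereal (C * T * (ln (1 / u) / u))"
    if F: "is_dirichlet_continuation a F" and u: "0 < u" "u \<le> 1 / 2" and T: "1 \<le> T" for F u T
  proof -
    define Z0 where "Z0 = zeros_in F (1 / 2 + u) \<infinity> T"
    define m where "m = (\<lambda>\<rho>. nat (zorder F \<rho>))"
    have nice: "F nicely_meromorphic_on UNIV" using F by (simp add: is_dirichlet_continuation_def)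
    have p: "(\<lambda>s. 1 - 2 powr (1 - s)) analytic_on {s}" for s :: complex
      by (intro analytic_intros) auto
    have eq: "G s = (1 - 2 powr (1 - s)) * F s" if "Re s > 1" for s
      using LIMSEQ_unique[OF lim] dirichlet_continuation_relation[OF F that] that by (auto simp: b_def)
    have zero: "zorder F \<rho> > 0" "G \<rho> = 0"
      "\<exists>h. h analytic_on {\<rho>} \<and> eventually (\<lambda>s. G s = (s - \<rho>) ^ m \<rho> * h s) (nhds \<rho>)"
      "1 / 2 + u < Re \<rho>" "\<bar>Im \<rho>\<bar> \<le> T" if "\<rho> \<in> Z0" for \<rho>
    proof -
      show \<rho>: "1 / 2 + u < Re \<rho>" "\<bar>Im \<rho>\<bar> \<le> T" using that by (auto simp: Z0_def zeros_in_def)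
      have pos: "Re \<rho> > 0" and F0: "F \<midarrow>\<rho>\<rightarrow> 0" using that u by (auto simp: Z0_def zeros_in_def)
      have w0: "Re (of_real \<sigma>) > 0" "G (of_real \<sigma>) \<noteq> 0"
        using G_nz[of "of_real \<sigma>"] \<sigma>(1) by auto
      show "zorder F \<rho> > 0"
        by (rule zero_local_factorization(1)[OF nice G p _ pos F0 w0]) (use eq in blast)
      show "G \<rho> = 0"
        by (rule zero_local_factorization(2)[OF nice G p _ pos F0 w0]) (use eq in blast)
      show "\<exists>h. h analytic_on {\<rho>} \<and> eventually (\<lambda>s. G s = (s - \<rho>) ^ m \<rho> * h s) (nhds \<rho>)"
        unfolding m_def by (rule zero_local_factorization(3)[OF nice G p _ pos F0 w0]) (use eq in blast)
    qed
    have bound: "real (\<Sum>\<rho>\<in>Z. m \<rho>) \<le> C * T * (ln (1 / u) / u)" if "Z \<subseteq> Z0" "finite Z" for Z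
    proof (rule C(2)[OF u T that(2)])
      fix \<rho> assume "\<rho> \<in> Z"
      hence \<rho>: "\<rho> \<in> Z0" using that(1) by auto
      have "Re \<rho> < \<sigma>" using zero(2)[OF \<rho>] G_nz[of \<rho>] by force
      thus "1 / 2 + u < Re \<rho> \<and> Re \<rho> < \<sigma> \<and> \<bar>Im \<rho>\<bar> \<le> T" using zero(4,5)[OF \<rho>] by simp
      show "\<exists>h. h analytic_on {\<rho>} \<and> eventually (\<lambda>s. G s = (s - \<rho>) ^ m \<rho> * h s) (nhds \<rho>)"
        by (rule zero(3)[OF \<rho>])
    qed
    \<comment> \<open>Every multiplicity is at least \<open>1\<close>, so the bound for finite
      subsets also bounds their cardinality, and \<open>Z0\<close> is finite.\<close>
    have "card Z \<le> nat \<lceil>C * T * (ln (1 / u) / u)\<rceil>" if Z: "Z \<subseteq> Z0" "finite Z" for Z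
    proof -
      have "card Z = (\<Sum>\<rho>\<in>Z. 1)" by simp
      also have "\<dots> \<le> (\<Sum>\<rho>\<in>Z. m \<rho>)"
        using zero(1) Z by (intro sum_mono) (auto simp: m_def Suc_le_eq)
      finally show ?thesis using bound[OF Z] by linarith
    qed
    hence "finite Z0" using finite_if_finite_subsets_card_bdd by blast
    thus ?thesis using bound[OF order_refl]
      by (simp add: zero_count_def Z0_def m_def)
  qed
  thus ?thesis using C(1) by blast
qed

end
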